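(* Let $N\ge 2$ and let $H=(h_{k,j})\in\mathbb{R}^{(N-1)\times(N-1)}$ be a lower triangular matrix. Consider the algorithm which, given an operator $T$ and a starting point $y_0$, generates $$y_{k+1}=y_k-\sum_{j=0}^{k}h_{k+1,j+1}\,(y_j-Ty_j),\qquad k=0,\dots,N-2.$$ The algorithm achieves the exact optimal worst-case rate $$\|y_{N-1}-Ty_{N-1}\|^2\le\frac{4\|y_0-y_\star\|^2}{N^2}$$ over the class of nonexpansive operators (i.e. this inequality holds for every $d\ge1$, every nonexpansive $T:\mathbb{R}^d\to\mathbb{R}^d$ having a fixed point, every fixed point $y_\star$ of $T$, and every $y_0\in\mathbb{R}^d$) if and only if $$\begin{cases}P(N-1,m;H)=\dfrac1N\dbinom{N}{m+1}, & m=1,\dots,N-1,\\[2mm] \lambda^\star_{k,j}(H)\ge 0, & k=2,\dots,N,\ j=1,\dots,k-1.\end{cases}$$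
   Context: $T:\mathbb{R}^d\to\mathbb{R}^d$ is nonexpansive if $\|Tx-Ty\|\le\|x-y\|$ for all $x,y$ (Euclidean norm). For a lower triangular $H=(h_{i,j})\in\mathbb{R}^{(N-1)\times(N-1)}$ define the H-invariants, for $m=1,\dots,N-1$, $$P(N-1,m;H)=\sum_{1\le j(1)\le i(1)<j(2)\le i(2)<\cdots<j(m)\le i(m)\le N-1}\ \prod_{r=1}^m h_{i(r),j(r)}.$$ Define, for $m,j\in\{1,\dots,N-1\}$, the Q-functions $$Q(N-1,m,j;H)=\sum_{j=j(1)\le i(1)<j(2)\le i(2)<\cdots<j(m)\le i(m)\le N-1}\ \prod_{r=1}^m h_{i(r),j(r)}$$ (empty sums are $0$). The H-certificates $\lambda^\star_{k,j}(H)$, $1\le j<k\le N$, are $$\lambda^\star_{N,j}(H)=N\sum_{m=1}^{N-j}(-1)^{m-1}Q(N-1,m,j;H),\qquad j=1,\dots,N-1,$$ and for $1\le j<k\le N-1$ $$\lambda^\star_{k,j}(H)=N\sum_{\ell=1}^{N-j}\sum_{m=1}^{N-k}(-1)^{\ell+m-1}\binom{\ell+m}{m}Q(N-1,\ell,j;H)\,Q(N-1,m,k;H).$$ *)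

theory Defs
  imports Complex_Main "HOL-Library.FuncSet" "Jordan_Normal_Form.Matrix"
begin

text \<open>
  The dimension \<open>d\<close> is quantified inside the statement, so \<open>\<real>\<^sup>d\<close> is rendered as
  \<open>carrier_vec d\<close>. Library matrices are indexed from \<open>0\<close>, whereas \<open>H_entry\<close> is indexed from \<open>1\<close>:
  \<open>H_entry H i j\<close> with \<open>1 \<le> i, j\<close> is the entry \<open>H $$ (i - 1, j - 1)\<close>.
\<close>

definition lower_triangular :: "real mat \<Rightarrow> bool" where
  "lower_triangular A \<longleftrightarrow> (\<forall>i<dim_row A. \<forall>j<dim_col A. i < j \<longrightarrow> A $$ (i, j) = 0)"

abbreviation H_entry :: "real mat \<Rightarrow> nat \<Rightarrow> nat \<Rightarrow> real" where
  "H_entry H i j \<equiv> H $$ (i - 1, j - 1)"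

definition vec_norm :: "real vec \<Rightarrow> real" where
  "vec_norm v = sqrt (v \<bullet> v)"

definition nonexpansive :: "nat \<Rightarrow> (real vec \<Rightarrow> real vec) \<Rightarrow> bool" where
  "nonexpansive d T \<longleftrightarrow>
     T \<in> carrier_vec d \<rightarrow> carrier_vec d \<and>
     (\<forall>x\<in>carrier_vec d. \<forall>y\<in>carrier_vec d. vec_norm (T x - T y) \<le> vec_norm (x - y))"

text \<open>
  \<open>y 0, \<dots>, y (N - 1)\<close> are the iterates in \<open>\<real>\<^sup>d\<close> produced by the algorithm with matrix \<open>H\<close> and
  starting point \<open>y 0\<close>; the values \<open>y k\<close> for \<open>k \<ge> N\<close> are unconstrained and irrelevant.
\<close>

definition generates ::
  "nat \<Rightarrow> real mat \<Rightarrow> nat \<Rightarrow> (real vec \<Rightarrow> real vec) \<Rightarrow> (nat \<Rightarrow> real vec) \<Rightarrow> bool" where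
  "generates N H d T y \<longleftrightarrow>
     y 0 \<in> carrier_vec d \<and>
     (\<forall>k<N - 1. y (k + 1) =
        y k - finsum_vec TYPE(real) d (\<lambda>j. H_entry H (k + 1) (j + 1) \<cdot>\<^sub>v (y j - T (y j))) {0..k})"

definition achieves_optimal_rate :: "nat \<Rightarrow> real mat \<Rightarrow> bool" where
  "achieves_optimal_rate N H \<longleftrightarrow>
     (\<forall>d\<ge>1. \<forall>T. nonexpansive d T \<longrightarrow>
       (\<forall>ystar\<in>carrier_vec d. T ystar = ystar \<longrightarrow>
         (\<forall>y. generates N H d T y \<longrightarrow>
           (vec_norm (y (N - 1) - T (y (N - 1))))\<^sup>2
             \<le> 4 * (vec_norm (y 0 - ystar))\<^sup>2 / (real N)\<^sup>2)))"

text \<open>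
  Index tuples \<open>j(1) \<le> i(1) < j(2) \<le> i(2) < \<dots> < j(m) \<le> i(m)\<close> in \<open>{1..n}\<close>, as pairs \<open>(i, j)\<close> of
  functions that are extensional on \<open>{1..m}\<close>, so that each tuple occurs exactly once.
\<close>

definition index_chains :: "nat \<Rightarrow> nat \<Rightarrow> ((nat \<Rightarrow> nat) \<times> (nat \<Rightarrow> nat)) set" where
  "index_chains n m = {(i, j).
     i \<in> {1..m} \<rightarrow>\<^sub>E {1..n} \<and> j \<in> {1..m} \<rightarrow>\<^sub>E {1..n} \<and>
     (\<forall>r\<in>{1..m}. j r \<le> i r) \<and> (\<forall>r\<in>{1..<m}. i r < j (r + 1))}"

definition P_inv :: "nat \<Rightarrow> nat \<Rightarrow> real mat \<Rightarrow> real" where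
  "P_inv n m H = (\<Sum>(i, j)\<in>index_chains n m. \<Prod>r=1..m. H_entry H (i r) (j r))"

definition Q_fun :: "nat \<Rightarrow> nat \<Rightarrow> nat \<Rightarrow> real mat \<Rightarrow> real" where
  "Q_fun n m j0 H =
     (\<Sum>(i, j)\<in>{(i, j) \<in> index_chains n m. j 1 = j0}. \<Prod>r=1..m. H_entry H (i r) (j r))"

definition H_certificate :: "nat \<Rightarrow> real mat \<Rightarrow> nat \<Rightarrow> nat \<Rightarrow> real" where
  "H_certificate N H k j =
     (if k = N
      then real N * (\<Sum>m=1..N - j. (- 1) ^ (m - 1) * Q_fun (N - 1) m j H)
      else real N * (\<Sum>l=1..N - j. \<Sum>m=1..N - k.
             (- 1) ^ (l + m - 1) * real ((l + m) choose m) *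
             Q_fun (N - 1) l j H * Q_fun (N - 1) m k H))"

end

theory Submission
  imports Defs
begin

text \<open>
  Write \<open>n = N - 1\<close>, index the iterates as \<open>x 0, \<dots>, x n\<close>, and put \<open>g k = x k - T (x k)\<close>.

  Sufficiency: extend the Q-functions by the monomial \<open>1\<close> at the last index \<open>n\<close>. All certificates then
  become \<open>-N B(Q\<^sub>j, Q\<^sub>k)\<close> for the bilinear form \<open>B(z\<^sup>l, z\<^sup>m) = (-1)\<^sup>l\<^sup>+\<^sup>m ((l + m) choose m)\<close>, and summation by
  parts together with Pascal's rule for \<open>B\<close> shows that the certificate-weighted sum of the
  nonexpansiveness inequalities between iterates equals \<open>\<langle>x 0 - x n, g n\<rangle> - n/2 \<parallel>g n\<parallel>\<^sup>2\<close>. Adding the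
  inequality between \<open>x n\<close> and the fixed point gives the rate.

  Necessity of the P-conditions: run the algorithm from \<open>(1, \<dots>, 1)\<close> on the negacyclic shift of \<open>\<real>\<^sup>N\<close>.
  The entries of \<open>g n\<close> sum to \<open>2\<close>, so the rate forces \<open>g n = (2/N, \<dots>, 2/N)\<close>, and binomial inversion
  recovers the H-invariants.

  Necessity of the certificates: precompose the shift with the fold along a hyperplane that contains
  the fixed point \<open>0\<close> and separates, to first order in \<open>e\<close>, only \<open>x k0\<close> from \<open>x j0\<close>. The fold breaks the
  isometry for that pair alone, and as \<open>e\<close> tends to \<open>0\<close> the identity turns the rate into
  \<open>certificate k0 j0 \<ge> 0\<close>.
\<close>

subsection \<open>Chain weights and alternating binomial sums\<close>

text \<open>
  \<open>chain_weight a n m j\<close> is \<open>Q(n, m, j + 1)\<close> for \<open>m \<ge> 1\<close>, \<open>j < n\<close>, with \<open>a\<close> the matrix indexed from \<open>0\<close>; the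
  extra index \<open>j = n\<close> carries the monomial \<open>1\<close>.
\<close>
fun chain_weight :: "(nat \<Rightarrow> nat \<Rightarrow> real) \<Rightarrow> nat \<Rightarrow> nat \<Rightarrow> nat \<Rightarrow> real" where
  "chain_weight a n 0 j = (if j = n then 1 else 0)"
| "chain_weight a n (Suc m) j = (\<Sum>i\<in>{j..<n}. a i j * (\<Sum>k\<in>{i<..n}. chain_weight a n m k))"

text \<open>Each of the \<open>m\<close> factors takes its own index \<open>i\<close> from
  \<open>{j..<n}\<close>, and these indices increase strictly, so at most \<open>n - j\<close> of
  them fit.\<close>

lemma chain_weight_eq_0: "n < m + j \<Longrightarrow> chain_weight a n m j = 0"
proof (induction m arbitrary: j)
  case 0
  then show ?case by simp
next
  case (Suc m)
  then show ?case by (auto intro!: sum.neutral)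
qed

text \<open>These are the coefficients of 1 / (1 + x + y) at x^l y^m; the recursions below say that
  the product with 1 + x + y is 1.\<close>

definition signed_choose :: "nat \<Rightarrow> nat \<Rightarrow> real" where
  "signed_choose l m = (- 1) ^ (l + m) * real ((l + m) choose m)"

lemma signed_choose_0_0 [simp]: "signed_choose 0 0 = 1"
  and signed_choose_0_Suc: "signed_choose 0 (Suc m) = - signed_choose 0 m"
  and signed_choose_Suc_0: "signed_choose (Suc l) 0 = - signed_choose l 0"
  and signed_choose_Suc_Suc: "signed_choose (Suc l) (Suc m) = - signed_choose l (Suc m) - signed_choose (Suc l) m"
  by (simp_all add: signed_choose_def algebra_simps)

lemma signed_choose_commute: "signed_choose l m = signed_choose m l"
  using binomial_symmetric[of m "l + m"] by (simp add: signed_choose_def add.commute)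

text \<open>An \<open>N\<close>-th finite difference annihilates polynomials in \<open>m\<close> of
  degree \<open>p < N\<close>. Pascal's rule for the first binomial turns the sum into a difference
  in \<open>c\<close>; Pascal's rule for the second lowers \<open>p\<close>.\<close>

lemma alternating_sum_choose_mult:
  assumes "p < N"
  shows "(\<Sum>m\<le>N. (- 1) ^ m * real (N choose m) * real ((c + m) choose p)) = 0"
  using assms
proof (induction N arbitrary: c p)
  case 0
  then show ?case by simp
next
  case (Suc N)
  let ?G = "\<lambda>c p. \<Sum>m\<le>N. (- 1) ^ m * real (N choose m) * real ((c + m) choose p)"
  have "(\<Sum>m\<le>Suc N. (- 1) ^ m * real (Suc N choose m) * real ((c + m) choose p))
      = real (c choose p) + (\<Sum>m\<le>N. (- 1) ^ Suc m * real (Suc N choose Suc m) * real ((c + Suc m) choose p))"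
    by (subst sum.atMost_Suc_shift) simp
  also have "\<dots> = (real (c choose p) + (\<Sum>m\<le>N. (- 1) ^ Suc m * real (N choose Suc m) * real ((c + Suc m) choose p)))
      - ?G (Suc c) p"
    by (simp add: algebra_simps sum.distrib sum_negf sum_subtractf)
  also have "real (c choose p) + (\<Sum>m\<le>N. (- 1) ^ Suc m * real (N choose Suc m) * real ((c + Suc m) choose p))
      = (\<Sum>m\<le>Suc N. (- 1) ^ m * real (N choose m) * real ((c + m) choose p))"
    by (subst sum.atMost_Suc_shift) simp
  also have "\<dots> = ?G c p" by simp
  finally have eq: "(\<Sum>m\<le>Suc N. (- 1) ^ m * real (Suc N choose m) * real ((c + m) choose p))
      = ?G c p - ?G (Suc c) p" .
  show ?case
  proof (cases p)
    case 0
    then show ?thesis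
      using eq by (simp del: sum.atMost_Suc binomial_Suc_Suc)
  next
    case (Suc p')
    have "?G (Suc c) p = ?G c p + ?G c p'"
      by (simp add: Suc algebra_simps sum.distrib)
    moreover have "?G c p' = 0" using Suc Suc.prems by (intro Suc.IH) simp
    ultimately show ?thesis
      using eq by (simp del: sum.atMost_Suc binomial_Suc_Suc)
  qed
qed

text \<open>As a polynomial in \<open>m + 1\<close>, the binomial \<open>(l + m) choose m\<close>
  has degree \<open>l\<close>, so the finite difference of order \<open>n + 1\<close> kills it and
  only the missing term at \<open>0\<close> is left. Under the P-conditions this evaluates the row
  sums of the certificate matrix.\<close>

lemma signed_choose_optimal:
  assumes "l \<le> n"
  shows "(\<Sum>m\<le>n. signed_choose l m * (real (Suc n choose Suc m) / real (Suc n))) = (if l = 0 then 1 / real (Suc n) else 0)"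
proof -
  \<comment> \<open>For \<open>l = 0\<close> the truncated \<open>l - 1\<close> does no harm: the
    lower index of the binomial is then \<open>0\<close>, so its value is \<open>1\<close>.\<close>
  have "(\<Sum>m\<le>Suc n. (- 1) ^ m * real (Suc n choose m) * real ((l - 1 + m) choose l))
     = real ((l - 1) choose l) - (\<Sum>m\<le>n. (- 1) ^ m * real (Suc n choose Suc m) * real ((l - 1 + Suc m) choose l))"
    by (subst sum.atMost_Suc_shift) (simp add: sum_negf)
  then have "(\<Sum>m\<le>n. (- 1) ^ m * real (Suc n choose Suc m) * real ((l - 1 + Suc m) choose l)) = real ((l - 1) choose l)"
    using alternating_sum_choose_mult[of l "Suc n" "l - 1"] assms by simp
  moreover have "(l - 1 + Suc m) choose l = (l + m) choose m" for m
    using binomial_symmetric[of m "l + m"] by (cases l) auto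
  moreover have "(l - 1) choose l = (if l = 0 then 1 else 0)"
    by auto
  ultimately have *: "(\<Sum>m\<le>n. (- 1) ^ m * real (Suc n choose Suc m) * real ((l + m) choose m)) = (if l = 0 then 1 else 0)"
    by simp
  have "(\<Sum>m\<le>n. signed_choose l m * (real (Suc n choose Suc m) / real (Suc n)))
     = (- 1) ^ l / real (Suc n) * (\<Sum>m\<le>n. (- 1) ^ m * real (Suc n choose Suc m) * real ((l + m) choose m))"
    by (simp add: signed_choose_def sum_distrib_left power_add mult_ac)
  then show ?thesis by (simp only: *) simp
qed

text \<open>The matrix with entries \<open>(- 1) ^ r * (m choose r)\<close> is its own inverse,
  which is \<open>orth\<close>. Applying it to the constant sequence \<open>c\<close> sums
  \<open>r choose p\<close> over \<open>r\<close>, and the hockey-stick identity gives the closed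
  form.\<close>

lemma alternating_choose_inversion:
  fixes s :: "nat \<Rightarrow> real"
  assumes "\<And>r. r \<le> n \<Longrightarrow> (- 1) ^ r * (\<Sum>m\<le>n. (- 1) ^ m * s m * real (m choose r)) = c"
    and "p \<le> n"
  shows "s p = c * real (Suc n choose Suc p)"
proof -
  have orth: "(\<Sum>r\<le>n. (- 1) ^ r * real (m choose r) * real (r choose p)) = (if m = p then (- 1) ^ p else 0)"
    if "m \<le> n" for m
  proof -
    have "(\<Sum>r\<le>n. (- 1) ^ r * real (m choose r) * real (r choose p))
        = (\<Sum>r\<le>m. (- 1) ^ r * real (m choose r) * real (r choose p))"
      using that by (intro sum.mono_neutral_right) auto
    also have "\<dots> = (if m = p then (- 1) ^ p else 0)"
    proof (cases m p rule: linorder_cases)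
      case less
      then show ?thesis by (auto intro!: sum.neutral)
    next
      case equal
      have "(\<Sum>r\<le>p. (- 1) ^ r * real (p choose r) * real (r choose p)) = (\<Sum>r\<in>{p}. (- 1) ^ r * real (p choose r) * real (r choose p))"
        by (intro sum.mono_neutral_right) auto
      with equal show ?thesis by simp
    next
      case greater
      then show ?thesis using alternating_sum_choose_mult[of p m 0] by simp
    qed
    finally show ?thesis .
  qed
  have "c * real (Suc n choose Suc p) = (\<Sum>r\<le>n. c * real (r choose p))"
    by (simp only: sum_distrib_left[symmetric] of_nat_sum[symmetric] sum_choose_upper)
  also have "\<dots> = (\<Sum>r\<le>n. \<Sum>m\<le>n. (- 1) ^ m * s m * ((- 1) ^ r * real (m choose r) * real (r choose p)))"
    by (intro sum.cong refl) (simp add: assms(1)[symmetric] sum_distrib_left sum_distrib_right mult_ac)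
  also have "\<dots> = (\<Sum>m\<le>n. (- 1) ^ m * s m * (\<Sum>r\<le>n. (- 1) ^ r * real (m choose r) * real (r choose p)))"
    by (subst sum.swap) (simp add: sum_distrib_left)
  also have "\<dots> = (\<Sum>m\<le>n. if m = p then s p else 0)"
    by (intro sum.cong refl) (auto simp: orth simp flip: power_add)
  also have "\<dots> = s p" using assms(2) by simp
  finally show ?thesis by simp
qed

text \<open>Summation by parts: every \<open>x j\<close> is \<open>x 0\<close> minus the steps made
  before \<open>j\<close>. Exchanging the sums leaves, as coefficient of \<open>g j\<close>, the
  recursion that defines the next chain weight.\<close>

lemma chain_weight_abel:
  assumes step: "\<And>k. k < n \<Longrightarrow> x (Suc k) = x k - (\<Sum>j\<le>k. a k j * g j)"
  shows "(\<Sum>j\<le>n. chain_weight a n m j * x j)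
    = (\<Sum>j\<le>n. chain_weight a n m j) * x 0 - (\<Sum>j\<le>n. chain_weight a n (Suc m) j * g j)"
proof -
  let ?q = "chain_weight a n"
  define d where "d i = (\<Sum>j\<le>i. a i j * g j)" for i
  have x: "x j = x 0 - (\<Sum>i<j. d i)" if "j \<le> n" for j
    using that by (induction j) (auto simp: step d_def)
  have "(\<Sum>j\<le>n. ?q m j * x j) = (\<Sum>j\<le>n. ?q m j * x 0 - (\<Sum>i<j. ?q m j * d i))"
    by (intro sum.cong refl) (subst x, simp, simp add: right_diff_distrib sum_distrib_left)
  also have "\<dots> = (\<Sum>j\<le>n. ?q m j) * x 0 - (\<Sum>j\<le>n. \<Sum>i<j. ?q m j * d i)"
    by (simp add: sum_subtractf sum_distrib_right)
  also have "(\<Sum>j\<le>n. \<Sum>i<j. ?q m j * d i) = (\<Sum>i<n. d i * (\<Sum>j\<in>{i<..n}. ?q m j))"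
    by (simp add: sum.nested_swap' atLeastSucAtMost_greaterThanAtMost sum_distrib_left mult_ac)
  also have "\<dots> = (\<Sum>i<n. \<Sum>j\<in>{j\<in>{..n}. j \<le> i}. a i j * g j * (\<Sum>k\<in>{i<..n}. ?q m k))"
    unfolding d_def sum_distrib_right by (intro sum.cong refl) auto
  also have "\<dots> = (\<Sum>j\<le>n. \<Sum>i\<in>{i\<in>{..<n}. j \<le> i}. a i j * g j * (\<Sum>k\<in>{i<..n}. ?q m k))"
    by (rule sum.swap_restrict) auto
  also have "\<dots> = (\<Sum>j\<le>n. ?q (Suc m) j * g j)"
  proof (intro sum.cong refl)
    fix j
    have "{i \<in> {..<n}. j \<le> i} = {j..<n}" by auto
    then show "(\<Sum>i\<in>{i\<in>{..<n}. j \<le> i}. a i j * g j * (\<Sum>k\<in>{i<..n}. ?q m k)) = ?q (Suc m) j * g j"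
      by (simp add: sum_distrib_left sum_distrib_right mult_ac)
  qed
  finally show ?thesis .
qed

subsection \<open>The certificate identity\<close>

definition certificate :: "(nat \<Rightarrow> nat \<Rightarrow> real) \<Rightarrow> nat \<Rightarrow> nat \<Rightarrow> nat \<Rightarrow> real" where
  "certificate a n k j = - real (Suc n) *
    (\<Sum>l\<le>n. \<Sum>m\<le>n. signed_choose l m * chain_weight a n l j * chain_weight a n m k)"

text \<open>This pairs the product of 1 + x + y with its inverse series against
  \<open>G l * G m\<close>: multiplication by x or y becomes a shift of one index, the symmetry of
  \<open>signed_choose\<close> merges the two shifted sums, and \<open>G (Suc n) = 0\<close> removes
  the boundary terms.\<close>

lemma signed_choose_quadratic:
  fixes G :: "nat \<Rightarrow> real"
  assumes "G (Suc n) = 0"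
  shows "(\<Sum>l\<le>n. \<Sum>m\<le>n. signed_choose l m * G l * G m)
    + 2 * (\<Sum>l\<le>n. \<Sum>m\<le>n. signed_choose l m * G (Suc l) * G m) = (G 0)\<^sup>2"
proof -
  \<comment> \<open>\<open>A\<close> and \<open>C\<close> split the shifted sum at
    \<open>m = 0\<close>. Apart from the corner \<open>(G 0)^2\<close>, the unshifted sum also
    consists of multiples of \<open>A\<close> and \<open>C\<close>.\<close>
  define A where "A = (\<Sum>l\<le>n. signed_choose l 0 * G (Suc l) * G 0)"
  define C where "C = (\<Sum>l\<le>n. \<Sum>m\<le>n. signed_choose l (Suc m) * G (Suc l) * G (Suc m))"
  have E: "(\<Sum>l\<le>n. \<Sum>m\<le>n. signed_choose l m * G (Suc l) * G m) = A + C"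
  proof -
    have "(\<Sum>l\<le>n. \<Sum>m\<le>n. signed_choose l m * G (Suc l) * G m)
      = (\<Sum>l\<le>n. \<Sum>m\<le>Suc n. signed_choose l m * G (Suc l) * G m)"
      using assms by simp
    also have "\<dots> = A + C"
      by (subst sum.atMost_Suc_shift) (simp add: A_def C_def sum.distrib)
    finally show ?thesis .
  qed
  have C': "C = (\<Sum>l\<le>n. \<Sum>m\<le>n. signed_choose (Suc l) m * G (Suc l) * G (Suc m))"
    unfolding C_def by (subst sum.swap) (simp add: signed_choose_commute[of _ "Suc _"] mult_ac)
  have A': "A = (\<Sum>m\<le>n. signed_choose 0 m * G 0 * G (Suc m))"
    unfolding A_def by (simp add: signed_choose_commute[of _ 0] mult_ac)
  have "(\<Sum>l\<le>n. \<Sum>m\<le>n. signed_choose l m * G l * G m)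
    = (\<Sum>l\<le>Suc n. \<Sum>m\<le>Suc n. signed_choose l m * G l * G m)"
    using assms by simp
  also have "\<dots> = (G 0)\<^sup>2 + (\<Sum>m\<le>n. signed_choose 0 (Suc m) * G 0 * G (Suc m))
    + (\<Sum>l\<le>n. signed_choose (Suc l) 0 * G (Suc l) * G 0)
    + (\<Sum>l\<le>n. \<Sum>m\<le>n. signed_choose (Suc l) (Suc m) * G (Suc l) * G (Suc m))"
    by (simp only: sum.atMost_Suc_shift sum.distrib) (simp add: power2_eq_square)
  also have "(\<Sum>m\<le>n. signed_choose 0 (Suc m) * G 0 * G (Suc m)) = - A"
    unfolding A' by (simp add: signed_choose_0_Suc sum_negf)
  also have "(\<Sum>l\<le>n. signed_choose (Suc l) 0 * G (Suc l) * G 0) = - A"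
    unfolding A_def by (simp add: signed_choose_Suc_0 sum_negf)
  also have "(\<Sum>l\<le>n. \<Sum>m\<le>n. signed_choose (Suc l) (Suc m) * G (Suc l) * G (Suc m)) = - C - C"
    by (subst (2) C', subst C_def) (simp add: signed_choose_Suc_Suc sum_negf sum_subtractf algebra_simps)
  finally show ?thesis unfolding E by simp
qed

lemma sum_symmetric_half:
  fixes f :: "nat \<Rightarrow> nat \<Rightarrow> real"
  assumes "\<And>k j. f k j = f j k" "\<And>k. f k k = 0"
  shows "(\<Sum>k\<le>n. \<Sum>j\<le>n. f k j) = 2 * (\<Sum>k\<le>n. \<Sum>j<k. f k j)"
proof (induction n)
  case 0
  then show ?case using assms(2) by simp
next
  case (Suc n)
  have "(\<Sum>k\<le>n. f k (Suc n)) = (\<Sum>k\<le>n. f (Suc n) k)"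
    using assms(1) by simp
  then show ?case
    using Suc assms(2) by (simp add: sum.distrib lessThan_Suc_atMost)
qed

lemma bilinear_sum:
  fixes s :: "nat \<Rightarrow> nat \<Rightarrow> real"
  shows "(\<Sum>j\<le>n. \<Sum>k\<le>n. (\<Sum>l\<le>n. \<Sum>m\<le>n. s l m * q l j * q m k) * x j * y k)
    = (\<Sum>l\<le>n. \<Sum>m\<le>n. s l m * (\<Sum>j\<le>n. q l j * x j) * (\<Sum>k\<le>n. q m k * y k))"
proof -
  have "(\<Sum>j\<le>n. \<Sum>k\<le>n. (\<Sum>l\<le>n. \<Sum>m\<le>n. s l m * q l j * q m k) * x j * y k)
    = (\<Sum>j\<le>n. \<Sum>k\<le>n. \<Sum>l\<le>n. \<Sum>m\<le>n. s l m * (q l j * x j) * (q m k * y k))"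
    by (simp add: sum_distrib_left sum_distrib_right mult_ac)
  also have "\<dots> = (\<Sum>j\<le>n. \<Sum>l\<le>n. \<Sum>k\<le>n. \<Sum>m\<le>n. s l m * (q l j * x j) * (q m k * y k))"
    by (intro sum.cong refl sum.swap)
  also have "\<dots> = (\<Sum>l\<le>n. \<Sum>j\<le>n. \<Sum>k\<le>n. \<Sum>m\<le>n. s l m * (q l j * x j) * (q m k * y k))"
    by (rule sum.swap)
  also have "\<dots> = (\<Sum>l\<le>n. \<Sum>j\<le>n. \<Sum>m\<le>n. \<Sum>k\<le>n. s l m * (q l j * x j) * (q m k * y k))"
    by (intro sum.cong refl sum.swap)
  also have "\<dots> = (\<Sum>l\<le>n. \<Sum>m\<le>n. \<Sum>j\<le>n. \<Sum>k\<le>n. s l m * (q l j * x j) * (q m k * y k))"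
    by (intro sum.cong refl sum.swap)
  also have "\<dots> = (\<Sum>l\<le>n. \<Sum>m\<le>n. s l m * (\<Sum>j\<le>n. q l j * x j) * (\<Sum>k\<le>n. q m k * y k))"
    by (simp add: sum_distrib_left sum_distrib_right mult_ac)
  finally show ?thesis .
qed

text \<open>Half of each bracket is \<open>w j + w k - x j * g k - x k * g j + g j * g k\<close>.
  Summed against the symmetric matrix \<open>B\<close>, the \<open>w\<close> terms see only its row
  sums, the mixed terms go through \<open>chain_weight_abel\<close>, and the remainder
  \<open>2 * E + E0\<close> collapses to \<open>(g n)^2\<close> by
  \<open>signed_choose_quadratic\<close>.\<close>

lemma certificate_identity:
  fixes x g :: "nat \<Rightarrow> real"
  assumes step: "\<And>k. k < n \<Longrightarrow> x (Suc k) = x k - (\<Sum>j\<le>k. a k j * g j)"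
    and opt: "\<And>m. m \<le> n \<Longrightarrow> (\<Sum>j\<le>n. chain_weight a n m j) = real (Suc n choose Suc m) / real (Suc n)"
  shows "(\<Sum>k\<le>n. \<Sum>j<k. certificate a n k j * ((x k - x j)\<^sup>2 - ((x k - g k) - (x j - g j))\<^sup>2)) / 2
    = (x 0 - x n) * g n - real n / 2 * (g n)\<^sup>2"
proof -
  let ?q = "chain_weight a n"
  define B where "B j k = (\<Sum>l\<le>n. \<Sum>m\<le>n. signed_choose l m * ?q l j * ?q m k)" for j k
  define D where "D k j = (x k - x j)\<^sup>2 - ((x k - g k) - (x j - g j))\<^sup>2" for k j
  define w where "w j = x j * g j - (g j)\<^sup>2 / 2" for j
  define G where "G m = (\<Sum>j\<le>n. ?q m j * g j)" for m
  define E where "E = (\<Sum>l\<le>n. \<Sum>m\<le>n. signed_choose l m * G (Suc l) * G m)"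
  define E0 where "E0 = (\<Sum>l\<le>n. \<Sum>m\<le>n. signed_choose l m * G l * G m)"
  have B_sym: "B j k = B k j" for j k
    unfolding B_def by (subst sum.swap) (simp add: signed_choose_commute mult_ac)
  have G0: "G 0 = g n"
    by (simp add: G_def if_distrib[of "\<lambda>u. u * _"] cong: if_cong)
  have GSuc: "G (Suc n) = 0"
    unfolding G_def by (intro sum.neutral ballI) (simp add: chain_weight_eq_0 del: chain_weight.simps)
  \<comment> \<open>Only \<open>l = 0\<close> survives the optimal row sums, and \<open>?q 0\<close>
    is the indicator of the last index.\<close>
  have row: "(\<Sum>k\<le>n. B j k) = (if j = n then 1 / real (Suc n) else 0)" for j
  proof -
    have "(\<Sum>k\<le>n. B j k) = (\<Sum>l\<le>n. \<Sum>k\<le>n. \<Sum>m\<le>n. signed_choose l m * ?q l j * ?q m k)"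
      unfolding B_def by (rule sum.swap)
    also have "\<dots> = (\<Sum>l\<le>n. \<Sum>m\<le>n. \<Sum>k\<le>n. signed_choose l m * ?q l j * ?q m k)"
      by (intro sum.cong refl sum.swap)
    also have "\<dots> = (\<Sum>l\<le>n. ?q l j * (\<Sum>m\<le>n. signed_choose l m * (\<Sum>k\<le>n. ?q m k)))"
      by (simp add: sum_distrib_left mult_ac)
    also have "\<dots> = (\<Sum>l\<le>n. ?q l j * (if l = 0 then 1 / real (Suc n) else 0))"
      by (intro sum.cong refl) (simp add: opt signed_choose_optimal
          del: chain_weight.simps times_divide_eq_right binomial_Suc_Suc of_nat_Suc)
    also have "\<dots> = (if j = n then 1 / real (Suc n) else 0)"
      by (simp add: if_distrib[of "\<lambda>u. _ * u"] cong: if_cong del: chain_weight.simps(2))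
    finally show ?thesis .
  qed
  have XG: "(\<Sum>j\<le>n. \<Sum>k\<le>n. B j k * x j * g k) = x 0 * g n / real (Suc n) - E"
  proof -
    have "(\<Sum>j\<le>n. \<Sum>k\<le>n. B j k * x j * g k)
      = (\<Sum>l\<le>n. \<Sum>m\<le>n. signed_choose l m * (\<Sum>j\<le>n. ?q l j * x j) * G m)"
      unfolding B_def G_def by (rule bilinear_sum)
    also have "\<dots> = (\<Sum>l\<le>n. \<Sum>m\<le>n. signed_choose l m * ((real (Suc n choose Suc l) / real (Suc n)) * x 0 - G (Suc l)) * G m)"
      by (intro sum.cong refl) (simp add: chain_weight_abel[OF step] opt G_def del: chain_weight.simps)
    also have "\<dots> = (\<Sum>l\<le>n. \<Sum>m\<le>n. signed_choose l m * (real (Suc n choose Suc l) / real (Suc n)) * x 0 * G m) - E"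
      unfolding E_def by (simp add: sum_subtractf algebra_simps)
    also have "(\<Sum>l\<le>n. \<Sum>m\<le>n. signed_choose l m * (real (Suc n choose Suc l) / real (Suc n)) * x 0 * G m)
      = (\<Sum>m\<le>n. x 0 * G m * (\<Sum>l\<le>n. signed_choose m l * (real (Suc n choose Suc l) / real (Suc n))))"
      by (subst sum.swap, intro sum.cong refl, subst signed_choose_commute)
         (simp add: sum_distrib_left mult_ac)
    also have "\<dots> = (\<Sum>m\<le>n. if m = 0 then x 0 * G m * (1 / real (Suc n)) else 0)"
      by (intro sum.cong refl) (simp add: signed_choose_optimal
          del: times_divide_eq_right binomial_Suc_Suc of_nat_Suc)
    also have "\<dots> = x 0 * g n / real (Suc n)"
      by (simp add: G0)
    finally show ?thesis .
  qed
  have GG: "(\<Sum>j\<le>n. \<Sum>k\<le>n. B j k * g j * g k) = E0"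
    unfolding B_def E0_def G_def by (rule bilinear_sum)
  have W: "(\<Sum>j\<le>n. \<Sum>k\<le>n. B j k * w j) = w n / real (Suc n)"
    by (simp add: row if_distrib[of "\<lambda>u. u * _"] flip: sum_distrib_right cong: if_cong)
  have D: "B j k * D j k / 2
      = B j k * w j + B k j * w k - B j k * x j * g k - B k j * x k * g j + B j k * g j * g k" for j k
    unfolding D_def w_def B_sym[of j k] by (simp add: power2_eq_square field_simps)
  have "(\<Sum>j\<le>n. \<Sum>k\<le>n. B j k * D j k / 2)
      = (\<Sum>j\<le>n. \<Sum>k\<le>n. B j k * w j) + (\<Sum>j\<le>n. \<Sum>k\<le>n. B k j * w k)
      - (\<Sum>j\<le>n. \<Sum>k\<le>n. B j k * x j * g k) - (\<Sum>j\<le>n. \<Sum>k\<le>n. B k j * x k * g j)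
      + (\<Sum>j\<le>n. \<Sum>k\<le>n. B j k * g j * g k)"
    unfolding D by (simp only: sum.distrib sum_subtractf)
  also have "(\<Sum>j\<le>n. \<Sum>k\<le>n. B k j * w k) = w n / real (Suc n)"
    unfolding W[symmetric] by (rule sum.swap)
  also have "(\<Sum>j\<le>n. \<Sum>k\<le>n. B k j * x k * g j) = x 0 * g n / real (Suc n) - E"
    unfolding XG[symmetric] by (rule sum.swap)
  finally have "(\<Sum>j\<le>n. \<Sum>k\<le>n. B j k * D j k / 2)
      = 2 * w n / real (Suc n) - 2 * (x 0 * g n / real (Suc n)) + (g n)\<^sup>2"
    using signed_choose_quadratic[of G n, OF GSuc] unfolding W XG GG G0 E_def[symmetric] E0_def[symmetric]
    by (simp add: mult.commute)
  also have "(\<Sum>j\<le>n. \<Sum>k\<le>n. B j k * D j k / 2) = (\<Sum>k\<le>n. \<Sum>j<k. B k j * D k j)"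
    by (subst sum_symmetric_half)
       (auto simp: B_sym D_def power2_eq_square sum_distrib_left algebra_simps simp flip: sum_divide_distrib)
  finally have "- real (Suc n) / 2 * (\<Sum>k\<le>n. \<Sum>j<k. B k j * D k j)
      = - real (Suc n) / 2 * (2 * w n / real (Suc n) - 2 * (x 0 * g n / real (Suc n)) + (g n)\<^sup>2)"
    by simp
  also have "\<dots> = (x 0 - x n) * g n - real n / 2 * (g n)\<^sup>2"
  proof -
    have "- s / 2 * (2 * w n / s - 2 * (x 0 * g n / s) + (g n)\<^sup>2) = (x 0 - x n) * g n - (s - 1) / 2 * (g n)\<^sup>2"
      if "s \<noteq> 0" for s
      using that by (simp add: w_def field_simps power2_eq_square)
    from this[of "real (Suc n)"] show ?thesis by simp
  qed
  also have "- real (Suc n) / 2 * (\<Sum>k\<le>n. \<Sum>j<k. B k j * D k j)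
      = (\<Sum>k\<le>n. \<Sum>j<k. certificate a n k j * D k j) / 2"
  proof -
    have "certificate a n k j = - real (Suc n) * B k j" for k j
      unfolding certificate_def B_sym[of k j] unfolding B_def ..
    then show ?thesis
      by (simp add: sum_distrib_left sum_divide_distrib mult.assoc del: of_nat_Suc)
  qed
  finally show ?thesis unfolding D_def .
qed

subsection \<open>Sums over index chains\<close>

lemma finite_index_chains: "finite (index_chains n m)"
proof (rule finite_subset)
  show "index_chains n m \<subseteq> ({1..m} \<rightarrow>\<^sub>E {1..n}) \<times> ({1..m} \<rightarrow>\<^sub>E {1..n})"
    by (auto simp: index_chains_def)
qed (intro finite_cartesian_product finite_PiE; simp)

text \<open>The guard \<open>1 \<le> m\<close> admits the empty chain for every \<open>s\<close>, so
  that a chain may end after any first pair.\<close>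

definition chains_above :: "nat \<Rightarrow> nat \<Rightarrow> nat \<Rightarrow> ((nat \<Rightarrow> nat) \<times> (nat \<Rightarrow> nat)) set" where
  "chains_above n m s = {(i, j) \<in> index_chains n m. 1 \<le> m \<longrightarrow> s < j 1}"

definition chain_prod :: "real mat \<Rightarrow> nat \<Rightarrow> (nat \<Rightarrow> nat) \<times> (nat \<Rightarrow> nat) \<Rightarrow> real" where
  "chain_prod H m = (\<lambda>(i, j). \<Prod>r=1..m. H_entry H (i r) (j r))"

text \<open>Tuples are handled like lists. Restriction to the index range keeps the results
  extensional, so that splitting off a head and attaching it are mutually inverse.\<close>

definition chain_tl :: "nat \<Rightarrow> (nat \<Rightarrow> nat) \<Rightarrow> nat \<Rightarrow> nat" where
  "chain_tl m i = (\<lambda>r\<in>{1..m}. i (Suc r))"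

definition chain_Cons :: "nat \<Rightarrow> nat \<Rightarrow> (nat \<Rightarrow> nat) \<Rightarrow> nat \<Rightarrow> nat" where
  "chain_Cons m c i = (\<lambda>r\<in>{1..Suc m}. if r = 1 then c else i (r - 1))"

lemma chain_Cons_1 [simp]: "chain_Cons m c i (Suc 0) = c"
  by (simp add: chain_Cons_def)

lemma chain_Cons_Suc [simp]: "r \<in> {1..m} \<Longrightarrow> chain_Cons m c i (Suc r) = i r"
  by (auto simp add: chain_Cons_def)

lemma chain_tl_Cons: "i \<in> {1..m} \<rightarrow>\<^sub>E A \<Longrightarrow> chain_tl m (chain_Cons m c i) = i"
  by (auto simp: chain_tl_def chain_Cons_def PiE_def extensional_def fun_eq_iff)

lemma chain_Cons_tl: "i \<in> {1..Suc m} \<rightarrow>\<^sub>E A \<Longrightarrow> chain_Cons m (i 1) (chain_tl m i) = i"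
  by (auto simp: chain_tl_def chain_Cons_def PiE_def extensional_def fun_eq_iff)

lemma index_Suc_cases:
  assumes "r \<in> {1..Suc m}"
  obtains "r = 1" | r' where "r = Suc r'" "r' \<in> {1..m}"
  using assms by (cases r) force+

lemma chain_Cons_in_PiE:
  assumes "i \<in> {1..m} \<rightarrow>\<^sub>E A" "c \<in> A"
  shows "chain_Cons m c i \<in> {1..Suc m} \<rightarrow>\<^sub>E A"
proof (rule PiE_I)
  fix r assume "r \<in> {1..Suc m}"
  then show "chain_Cons m c i r \<in> A"
    using assms by (cases rule: index_Suc_cases) auto
qed (auto simp: chain_Cons_def)

lemma chain_tl_in_PiE: "i \<in> {1..Suc m} \<rightarrow>\<^sub>E A \<Longrightarrow> chain_tl m i \<in> {1..m} \<rightarrow>\<^sub>E A"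
  by (auto simp: chain_tl_def PiE_iff extensional_def)

lemma chain_Cons_in_index_chains:
  assumes ch: "(i, j) \<in> chains_above n m c" and cd: "1 \<le> d" "d \<le> c" "c \<le> n"
  shows "(chain_Cons m c i, chain_Cons m d j) \<in> index_chains n (Suc m)"
proof -
  have ij: "i \<in> {1..m} \<rightarrow>\<^sub>E {1..n}" "j \<in> {1..m} \<rightarrow>\<^sub>E {1..n}"
    "\<And>r. r \<in> {1..m} \<Longrightarrow> j r \<le> i r" "\<And>r. r \<in> {1..<m} \<Longrightarrow> i r < j (Suc r)" "1 \<le> m \<Longrightarrow> c < j 1"
    using ch by (auto simp: chains_above_def index_chains_def)
  have "chain_Cons m d j r \<le> chain_Cons m c i r" if "r \<in> {1..Suc m}" for r
    using that cd ij(3) by (cases rule: index_Suc_cases) auto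
  moreover have "chain_Cons m c i r < chain_Cons m d j (Suc r)" if "r \<in> {1..<Suc m}" for r
  proof -
    from that have "r \<in> {1..Suc m}" by simp
    then show ?thesis
      using that ij(4,5) by (cases rule: index_Suc_cases) auto
  qed
  moreover have "chain_Cons m c i \<in> {1..Suc m} \<rightarrow>\<^sub>E {1..n}" "chain_Cons m d j \<in> {1..Suc m} \<rightarrow>\<^sub>E {1..n}"
    by (rule chain_Cons_in_PiE; use ij(1,2) cd in simp)+
  ultimately show ?thesis
    by (simp add: index_chains_def del: atLeastAtMost_iff)
qed

lemma chain_tl_in_chains_above:
  assumes "(i, j) \<in> index_chains n (Suc m)"
  shows "(chain_tl m i, chain_tl m j) \<in> chains_above n m (i 1)"
proof -
  have ij: "i \<in> {1..Suc m} \<rightarrow>\<^sub>E {1..n}" "j \<in> {1..Suc m} \<rightarrow>\<^sub>E {1..n}"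
    "\<And>r. r \<in> {1..Suc m} \<Longrightarrow> j r \<le> i r" "\<And>r. r \<in> {1..<Suc m} \<Longrightarrow> i r < j (Suc r)"
    using assms by (auto simp: index_chains_def)
  have "chain_tl m j r \<le> chain_tl m i r" if "r \<in> {1..m}" for r
    using that ij(3)[of "Suc r"] by (simp add: chain_tl_def)
  moreover have "chain_tl m i r < chain_tl m j (Suc r)" if "r \<in> {1..<m}" for r
    using that ij(4)[of "Suc r"] by (simp add: chain_tl_def)
  moreover have "i 1 < chain_tl m j 1" if "1 \<le> m"
    using that ij(4)[of 1] by (simp add: chain_tl_def)
  ultimately show ?thesis
    using ij(1,2)[THEN chain_tl_in_PiE] by (auto simp: index_chains_def chains_above_def)
qed

text \<open>A chain of \<open>m + 1\<close> pairs is its first pair \<open>(c, d)\<close> followed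
  by a chain of \<open>m\<close> pairs starting above \<open>c\<close>. This is the combinatorial
  source of the recursion of \<open>chain_weight\<close>.\<close>

lemma Q_fun_Suc:
  assumes "1 \<le> d"
  shows "Q_fun n (Suc m) d H = (\<Sum>c\<in>{d..n}. H_entry H c d * (\<Sum>p\<in>chains_above n m c. chain_prod H m p))"
proof -
  have fin: "finite (chains_above n m c)" for c
    by (rule finite_subset[OF _ finite_index_chains[of n m]]) (auto simp: chains_above_def)
  have "(\<Sum>c\<in>{d..n}. H_entry H c d * (\<Sum>p\<in>chains_above n m c. chain_prod H m p))
     = (\<Sum>(c, p)\<in>(SIGMA c:{d..n}. chains_above n m c). H_entry H c d * chain_prod H m p)"
    by (simp add: sum.Sigma fin sum_distrib_left)
  also have "\<dots> = (\<Sum>(i, j)\<in>{(i, j) \<in> index_chains n (Suc m). j 1 = d}. \<Prod>r=1..Suc m. H_entry H (i r) (j r))"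
  proof (rule sum.reindex_bij_witness[where
        i = "\<lambda>(i, j). (i 1, chain_tl m i, chain_tl m j)" and
        j = "\<lambda>(c, i, j). (chain_Cons m c i, chain_Cons m d j)"], goal_cases)
    case (1 x)
    then show ?case
      by (auto simp: chains_above_def index_chains_def chain_tl_Cons)
  next
    case (2 x)
    then show ?case
      using assms by (auto intro!: chain_Cons_in_index_chains)
  next
    case (3 x)
    then show ?case
      using chain_Cons_tl[of "fst x" m "{1..n}"] chain_Cons_tl[of "snd x" m "{1..n}"]
      by (auto simp: index_chains_def)
  next
    case (4 x)
    then show ?case
      using chain_tl_in_chains_above[of "fst x" "snd x" n m]
      by (auto simp: index_chains_def PiE_iff)
  next
    case (5 x)
    obtain c i j where x: "x = (c, i, j)" by (cases x)
    have "(\<Prod>r=1..Suc m. H_entry H (chain_Cons m c i r) (chain_Cons m d j r))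
      = H_entry H c d * (\<Prod>r=Suc 1..Suc m. H_entry H (chain_Cons m c i r) (chain_Cons m d j r))"
      by (subst prod.atLeast_Suc_atMost) (simp_all del: prod.cl_ivl_Suc)
    also have "(\<Prod>r=Suc 1..Suc m. H_entry H (chain_Cons m c i r) (chain_Cons m d j r)) = chain_prod H m (i, j)"
      unfolding prod.shift_bounds_cl_Suc_ivl chain_prod_def by simp
    finally show ?case by (simp add: x del: prod.cl_ivl_Suc)
  qed
  finally show ?thesis by (simp add: Q_fun_def)
qed

lemma sum_chains_above_Suc:
  "(\<Sum>p\<in>chains_above n (Suc m) s. chain_prod H (Suc m) p) = (\<Sum>d\<in>{s<..n}. Q_fun n (Suc m) d H)"
proof -
  have "chains_above n (Suc m) s = (\<Union>d\<in>{s<..n}. {(i, j) \<in> index_chains n (Suc m). j 1 = d})"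
    by (auto simp: chains_above_def index_chains_def PiE_iff)
  then show ?thesis
    unfolding Q_fun_def chain_prod_def
    by (simp only:, intro sum.UNION_disjoint ballI impI)
       (auto intro: finite_subset[OF _ finite_index_chains[of n "Suc m"]])
qed

text \<open>The claims alternate in one induction: the first for \<open>m\<close> gives the second
  for \<open>m\<close> by \<open>Q_fun_Suc\<close>, and summing the second over the start gives the
  first for \<open>m + 1\<close>. From 1-based to 0-based indices, a start \<open>d > s\<close>
  becomes \<open>k \<ge> s\<close>; the extra index \<open>k = n\<close> accounts for the empty
  chain.\<close>

lemma sum_chains_above_eq:
  assumes "s \<le> n"
  shows "(\<Sum>p\<in>chains_above n m s. chain_prod H m p) = (\<Sum>k\<in>{s..n}. chain_weight (\<lambda>i j. H $$ (i, j)) n m k)"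
  and "s < n \<Longrightarrow> Q_fun n (Suc m) (Suc s) H = chain_weight (\<lambda>i j. H $$ (i, j)) n (Suc m) s"
  using assms
proof (induction m arbitrary: s)
  case 0
  have chains_0: "chains_above n 0 s = {(\<lambda>_. undefined, \<lambda>_. undefined)}" for s
    by (auto simp: chains_above_def index_chains_def)
  have S: "(\<Sum>p\<in>chains_above n 0 s. chain_prod H 0 p) = 1" for s
    by (simp add: chains_0 chain_prod_def)
  {
    case 1
    then show ?case by (simp add: S)
  next
    case 2
    then show ?case
      by (simp add: Q_fun_Suc S sum.atLeast_Suc_atMost_Suc_shift)
         (rule sum.reindex_bij_witness[of _ Suc "\<lambda>i. i - 1"]; auto)
  }
next
  case (Suc m)
  let ?q = "chain_weight (\<lambda>i j. H $$ (i, j)) n"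
  have S: "(\<Sum>p\<in>chains_above n (Suc m) s. chain_prod H (Suc m) p) = (\<Sum>k\<in>{s..n}. ?q (Suc m) k)"
    if "s \<le> n" for s
  proof -
    have "(\<Sum>p\<in>chains_above n (Suc m) s. chain_prod H (Suc m) p) = (\<Sum>d\<in>{s<..n}. Q_fun n (Suc m) d H)"
      by (rule sum_chains_above_Suc)
    also have "\<dots> = (\<Sum>k\<in>{s..<n}. Q_fun n (Suc m) (Suc k) H)"
      by (rule sum.reindex_bij_witness[of _ Suc "\<lambda>i. i - 1"]) auto
    also have "\<dots> = (\<Sum>k\<in>{s..<n}. ?q (Suc m) k)"
      by (intro sum.cong refl Suc.IH(2)) auto
    \<comment> \<open>For positive length the weight at the added index \<open>n\<close> is an empty
      sum.\<close>
    also have "\<dots> = (\<Sum>k\<in>{s..n}. ?q (Suc m) k)"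
      by (intro sum.mono_neutral_left) auto
    finally show ?thesis .
  qed
  {
    case 1
    then show ?case by (rule S)
  next
    case 2
    have "Q_fun n (Suc (Suc m)) (Suc s) H
      = (\<Sum>c\<in>{Suc s..n}. H_entry H c (Suc s) * (\<Sum>k\<in>{c..n}. ?q (Suc m) k))"
      by (simp add: Q_fun_Suc S del: chain_weight.simps)
    also have "{Suc s..n} = Suc ` {s..<n}"
      by (simp only: image_Suc_atLeastLessThan atLeastLessThanSuc_atLeastAtMost)
    also have "(\<Sum>c\<in>Suc ` {s..<n}. H_entry H c (Suc s) * (\<Sum>k\<in>{c..n}. ?q (Suc m) k))
      = (\<Sum>i\<in>{s..<n}. H $$ (i, s) * (\<Sum>k\<in>{i<..n}. ?q (Suc m) k))"
      by (subst sum.reindex)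
         (simp_all add: atLeastSucAtMost_greaterThanAtMost[symmetric] del: chain_weight.simps sum.cl_ivl_Suc image_Suc_atLeastLessThan)
    finally show ?case by (simp only: chain_weight.simps(2)[of _ _ "Suc m"])
  }
qed

lemma P_inv_eq: "P_inv n m H = (\<Sum>k\<le>n. chain_weight (\<lambda>i j. H $$ (i, j)) n m k)"
proof -
  have "index_chains n m = chains_above n m 0"
    by (auto simp: chains_above_def index_chains_def PiE_iff Ball_def)
  then show ?thesis
    using sum_chains_above_eq(1)[where s = 0 and n = n and m = m and H = H] by (simp add: P_inv_def chain_prod_def atMost_atLeast0)
qed

text \<open>For an index \<open>j < n\<close> the weights vanish at \<open>l = 0\<close> and, by
  length, beyond \<open>l = n - j\<close>; this produces the summation ranges. For
  \<open>k = n\<close> only \<open>m = 0\<close> survives, which reduces the double sum to the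
  single sum of the last row.\<close>

lemma H_certificate_eq:
  assumes "j < k" "k \<le> n"
  shows "H_certificate (Suc n) H (Suc k) (Suc j) = certificate (\<lambda>i j. H $$ (i, j)) n k j"
proof -
  let ?q = "chain_weight (\<lambda>i j. H $$ (i, j)) n"
  have Q: "Q_fun n l (Suc i) H = ?q l i" if "1 \<le> l" "i < n" for l i
    using sum_chains_above_eq(2)[where s = i and n = n and m = "l - 1" and H = H] that by simp
  have restrict: "(\<Sum>l\<le>n. f l * ?q l i) = (\<Sum>l=1..n - i. f l * ?q l i)" if "i < n" for f i
    using that by (intro sum.mono_neutral_right) (auto simp: chain_weight_eq_0 Suc_le_eq simp del: chain_weight.simps(2))
  have "j < n" using assms by simp
  show ?thesis
  proof (cases "k = n")
    case True
    have inner: "(\<Sum>m\<le>n. signed_choose l m * ?q l j * ?q m n) = signed_choose l 0 * ?q l j" for l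
    proof -
      have "?q m n = (if m = 0 then 1 else 0)" for m by (cases m) auto
      then show ?thesis by (simp add: if_distrib[of "\<lambda>u. _ * u"] cong: if_cong)
    qed
    have "certificate (\<lambda>i j. H $$ (i, j)) n k j = - real (Suc n) * (\<Sum>l=1..n - j. signed_choose l 0 * ?q l j)"
      by (simp only: True certificate_def inner restrict[OF \<open>j < n\<close>])
    also have "(\<Sum>l=1..n - j. signed_choose l 0 * ?q l j) = (\<Sum>l=1..n - j. - ((- 1) ^ (l - 1) * ?q l j))"
      by (intro sum.cong refl) (auto simp: signed_choose_def power_eq_if simp del: chain_weight.simps)
    also have "- real (Suc n) * \<dots> = real (Suc n) * (\<Sum>l=1..n - j. (- 1) ^ (l - 1) * ?q l j)"
      unfolding sum_negf by (simp del: of_nat_Suc)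
    also have "\<dots> = H_certificate (Suc n) H (Suc k) (Suc j)"
      using assms True by (auto simp: H_certificate_def Q intro!: sum.cong simp del: chain_weight.simps)
    finally show ?thesis by simp
  next
    case False
    then have "k < n" using assms by simp
    have "certificate (\<lambda>i j. H $$ (i, j)) n k j
      = - real (Suc n) * (\<Sum>l\<le>n. (\<Sum>m\<le>n. signed_choose l m * ?q m k) * ?q l j)"
      unfolding certificate_def sum_distrib_right
      by (rule arg_cong[where f = "(*) _"]) (intro sum.cong refl, simp only: mult_ac)
    also have "\<dots> = - real (Suc n) * (\<Sum>l=1..n - j. (\<Sum>m=1..n - k. signed_choose l m * ?q m k) * ?q l j)"
      by (simp only: restrict[OF \<open>j < n\<close>] restrict[OF \<open>k < n\<close>])
    also have "(\<Sum>l=1..n - j. (\<Sum>m=1..n - k. signed_choose l m * ?q m k) * ?q l j)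
      = (\<Sum>l=1..n - j. \<Sum>m=1..n - k. - ((- 1) ^ (l + m - 1) * real ((l + m) choose m) * ?q l j * ?q m k))"
      unfolding sum_distrib_right
      by (intro sum.cong refl) (auto simp: signed_choose_def power_eq_if simp del: chain_weight.simps)
    also have "- real (Suc n) * \<dots> = real (Suc n) * (\<Sum>l=1..n - j. \<Sum>m=1..n - k.
             (- 1) ^ (l + m - 1) * real ((l + m) choose m) * ?q l j * ?q m k)"
      unfolding sum_negf by (simp del: of_nat_Suc)
    also have "\<dots> = H_certificate (Suc n) H (Suc k) (Suc j)"
      using assms False by (auto simp: H_certificate_def Q intro!: sum.cong simp del: chain_weight.simps)
    finally show ?thesis by simp
  qed
qed

subsection \<open>The rate in coordinates\<close>

lemma certificate_identity_vec:
  fixes x g :: "nat \<Rightarrow> nat \<Rightarrow> real"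
  assumes step: "\<And>k r. k < n \<Longrightarrow> r < d \<Longrightarrow> x (Suc k) r = x k r - (\<Sum>j\<le>k. a k j * g j r)"
    and opt: "\<And>m. m \<le> n \<Longrightarrow> (\<Sum>j\<le>n. chain_weight a n m j) = real (Suc n choose Suc m) / real (Suc n)"
  shows "(\<Sum>k\<le>n. \<Sum>j<k. certificate a n k j *
      ((\<Sum>r<d. (x k r - x j r)\<^sup>2) - (\<Sum>r<d. ((x k r - g k r) - (x j r - g j r))\<^sup>2))) / 2
    = (\<Sum>r<d. (x 0 r - x n r) * g n r) - real n / 2 * (\<Sum>r<d. (g n r)\<^sup>2)"
proof -
  have swap: "(\<Sum>k\<le>n. \<Sum>j<k. \<Sum>r<d. f k j r) = (\<Sum>r<d. \<Sum>k\<le>n. \<Sum>j<k. f k j r)"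
    for f :: "nat \<Rightarrow> nat \<Rightarrow> nat \<Rightarrow> real"
  proof -
    have "(\<Sum>k\<le>n. \<Sum>j<k. \<Sum>r<d. f k j r) = (\<Sum>k\<le>n. \<Sum>r<d. \<Sum>j<k. f k j r)"
      by (intro sum.cong refl sum.swap)
    also have "\<dots> = (\<Sum>r<d. \<Sum>k\<le>n. \<Sum>j<k. f k j r)"
      by (rule sum.swap)
    finally show ?thesis .
  qed
  have "(\<Sum>k\<le>n. \<Sum>j<k. certificate a n k j *
      ((\<Sum>r<d. (x k r - x j r)\<^sup>2) - (\<Sum>r<d. ((x k r - g k r) - (x j r - g j r))\<^sup>2))) / 2
    = (\<Sum>r<d. (\<Sum>k\<le>n. \<Sum>j<k. certificate a n k j *
      ((x k r - x j r)\<^sup>2 - ((x k r - g k r) - (x j r - g j r))\<^sup>2)) / 2)"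
    unfolding sum_subtractf[symmetric] sum_distrib_left sum_divide_distrib by (rule swap)
  also have "\<dots> = (\<Sum>r<d. (x 0 r - x n r) * g n r - real n / 2 * (g n r)\<^sup>2)"
    using step opt by (intro sum.cong refl certificate_identity) auto
  also have "\<dots> = (\<Sum>r<d. (x 0 r - x n r) * g n r) - real n / 2 * (\<Sum>r<d. (g n r)\<^sup>2)"
    by (simp add: sum_subtractf sum_distrib_left)
  finally show ?thesis .
qed

section \<open>Passage between vectors and coordinates\<close>

lemma vec_norm_sq: "v \<in> carrier_vec d \<Longrightarrow> (vec_norm v)\<^sup>2 = (\<Sum>r<d. (v $ r)\<^sup>2)"
  by (simp add: vec_norm_def scalar_prod_def atLeast0LessThan power2_eq_square sum_nonneg)

lemma nonexpansive_sq:
  assumes "nonexpansive d T" "x \<in> carrier_vec d" "y \<in> carrier_vec d"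
  shows "(\<Sum>r<d. (T x $ r - T y $ r)\<^sup>2) \<le> (\<Sum>r<d. (x $ r - y $ r)\<^sup>2)"
proof -
  have T: "T x \<in> carrier_vec d" "T y \<in> carrier_vec d"
    and "vec_norm (T x - T y) \<le> vec_norm (x - y)"
    using assms by (auto simp: nonexpansive_def)
  then have "(vec_norm (T x - T y))\<^sup>2 \<le> (vec_norm (x - y))\<^sup>2"
    by (intro power_mono) (auto simp: vec_norm_def scalar_prod_def intro!: sum_nonneg)
  then show ?thesis
    using assms(2,3) T by (subst (asm) (1 2) vec_norm_sq[of _ d]) auto
qed

lemma generates_carrier:
  assumes "nonexpansive d T" "generates (Suc n) H d T y" "k \<le> n"
  shows "y k \<in> carrier_vec d"
  using assms(3)
proof (induction k rule: less_induct)
  case (less k)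
  show ?case
  proof (cases k)
    case 0
    then show ?thesis using assms(2) by (simp add: generates_def)
  next
    case (Suc k')
    let ?f = "\<lambda>j. H_entry H (k' + 1) (j + 1) \<cdot>\<^sub>v (y j - T (y j))"
    have IH: "y j \<in> carrier_vec d" if "j \<le> k'" for j
      using less Suc that by simp
    have "?f \<in> {0..k'} \<rightarrow> carrier_vec d"
    proof
      fix j assume "j \<in> {0..k'}"
      then have "y j \<in> carrier_vec d" "T (y j) \<in> carrier_vec d"
        using IH[of j] assms(1) by (auto simp: nonexpansive_def)
      then show "?f j \<in> carrier_vec d" by simp
    qed
    then have "finsum_vec TYPE(real) d ?f {0..k'} \<in> carrier_vec d"
      by (rule finsum_vec_closed)
    moreover have "y k = y k' - finsum_vec TYPE(real) d ?f {0..k'}"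
      using assms(2) less.prems Suc by (simp add: generates_def)
    ultimately show ?thesis
      using IH[of k'] by simp
  qed
qed

lemma generates_coordinate:
  assumes "nonexpansive d T" "generates (Suc n) H d T y" "k < n" "r < d"
  shows "y (Suc k) $ r = y k $ r - (\<Sum>j\<le>k. H $$ (k, j) * (y j $ r - T (y j) $ r))"
proof -
  have y: "y j \<in> carrier_vec d" "T (y j) \<in> carrier_vec d" if "j \<le> k" for j
    using generates_carrier[OF assms(1,2), of j] assms(1,3) that by (auto simp: nonexpansive_def)
  let ?f = "\<lambda>j. H $$ (k, j) \<cdot>\<^sub>v (y j - T (y j))"
  have f: "?f \<in> {0..k} \<rightarrow> carrier_vec d"
    using y by auto
  have "y (Suc k) = y k - finsum_vec TYPE(real) d ?f {0..k}"
    using assms(2,3) by (auto simp: generates_def)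
  then have "y (Suc k) $ r = y k $ r - (\<Sum>j\<in>{0..k}. ?f j $ r)"
    using y[of k] assms(4) f finsum_vec_closed[OF f] by (simp add: index_finsum_vec)
  also have "(\<Sum>j\<in>{0..k}. ?f j $ r) = (\<Sum>j\<le>k. H $$ (k, j) * (y j $ r - T (y j) $ r))"
  proof (intro sum.cong)
    fix j assume "j \<in> {..k}"
    then show "?f j $ r = H $$ (k, j) * (y j $ r - T (y j) $ r)"
      using assms(4) y[of j] by simp
  qed auto
  finally show ?thesis .
qed

lemma achieves_optimal_rateI:
  assumes opt: "\<And>m. m \<le> n \<Longrightarrow> (\<Sum>j\<le>n. chain_weight (\<lambda>i j. H $$ (i, j)) n m j) = real (Suc n choose Suc m) / real (Suc n)"
    and cert: "\<And>k j. j < k \<Longrightarrow> k \<le> n \<Longrightarrow> 0 \<le> certificate (\<lambda>i j. H $$ (i, j)) n k j"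
  shows "achieves_optimal_rate (Suc n) H"
  unfolding achieves_optimal_rate_def
proof (intro allI impI ballI)
  fix d T s y
  assume T: "nonexpansive d T" and s: "s \<in> carrier_vec d" "T s = s" and y: "generates (Suc n) H d T y"
  let ?a = "\<lambda>i j. H $$ (i, j)"
  note carr = generates_carrier[OF T y]
  have Tc: "T v \<in> carrier_vec d" if "v \<in> carrier_vec d" for v
    using T that by (auto simp: nonexpansive_def)
  define g where "g r = y n $ r - T (y n) $ r" for r
  define z where "z r = y 0 $ r - s $ r" for r
  have "0 \<le> (\<Sum>k\<le>n. \<Sum>j<k. certificate ?a n k j *
      ((\<Sum>r<d. (y k $ r - y j $ r)\<^sup>2) - (\<Sum>r<d. (T (y k) $ r - T (y j) $ r)\<^sup>2))) / 2"
    using cert nonexpansive_sq[OF T] carr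
    by (intro divide_nonneg_nonneg sum_nonneg mult_nonneg_nonneg) auto
  also have "\<dots> = (\<Sum>r<d. (y 0 $ r - y n $ r) * g r) - real n / 2 * (\<Sum>r<d. (g r)\<^sup>2)"
    using certificate_identity_vec[of n d "\<lambda>k r. y k $ r" ?a "\<lambda>k r. y k $ r - T (y k) $ r",
        OF generates_coordinate[OF T y] opt]
    by (simp add: g_def)
  finally have 1: "real n / 2 * (\<Sum>r<d. (g r)\<^sup>2) \<le> (\<Sum>r<d. (y 0 $ r - y n $ r) * g r)"
    by simp
  \<comment> \<open>The fixed point contributes another half of the squared residual, raising the
    coefficient from \<open>n / 2\<close> to \<open>(n + 1) / 2\<close>.\<close>
  have "0 \<le> (\<Sum>r<d. (y n $ r - s $ r)\<^sup>2) - (\<Sum>r<d. (T (y n) $ r - s $ r)\<^sup>2)"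
    using nonexpansive_sq[OF T carr[of n] s(1)] s(2) by simp
  also have "\<dots> = (\<Sum>r<d. 2 * ((y n $ r - s $ r) * g r) - (g r)\<^sup>2)"
    unfolding sum_subtractf[symmetric]
    by (intro sum.cong refl) (simp add: g_def power2_eq_square algebra_simps)
  also have "\<dots> = 2 * (\<Sum>r<d. (y n $ r - s $ r) * g r) - (\<Sum>r<d. (g r)\<^sup>2)"
    by (simp add: sum_subtractf sum_distrib_left)
  finally have 2: "(\<Sum>r<d. (g r)\<^sup>2) / 2 \<le> (\<Sum>r<d. (y n $ r - s $ r) * g r)"
    by simp
  have "(\<Sum>r<d. z r * g r) = (\<Sum>r<d. (y 0 $ r - y n $ r) * g r) + (\<Sum>r<d. (y n $ r - s $ r) * g r)"
    unfolding z_def sum.distrib[symmetric] by (intro sum.cong refl) (simp add: algebra_simps)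
  moreover have "real (Suc n) / 2 * (\<Sum>r<d. (g r)\<^sup>2) = real n / 2 * (\<Sum>r<d. (g r)\<^sup>2) + (\<Sum>r<d. (g r)\<^sup>2) / 2"
    by (simp add: add_divide_distrib distrib_right)
  ultimately have 3: "real (Suc n) / 2 * (\<Sum>r<d. (g r)\<^sup>2) \<le> (\<Sum>r<d. z r * g r)"
    using 1 2 by linarith
  \<comment> \<open>Expanding this square stands in for the Cauchy-Schwarz inequality; it vanishes
    exactly in the extremal case of the rate.\<close>
  have "0 \<le> (\<Sum>r<d. (z r - real (Suc n) / 2 * g r)\<^sup>2)"
    by (intro sum_nonneg) simp
  also have "\<dots> = (\<Sum>r<d. (z r)\<^sup>2 - real (Suc n) * (z r * g r) + (real (Suc n))\<^sup>2 / 4 * (g r)\<^sup>2)"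
    by (intro sum.cong refl) (simp add: power2_eq_square field_simps)
  also have "\<dots> = (\<Sum>r<d. (z r)\<^sup>2) - real (Suc n) * (\<Sum>r<d. z r * g r) + (real (Suc n))\<^sup>2 / 4 * (\<Sum>r<d. (g r)\<^sup>2)"
    by (simp only: sum.distrib sum_subtractf sum_distrib_left)
  also have "\<dots> \<le> (\<Sum>r<d. (z r)\<^sup>2) - real (Suc n) * (real (Suc n) / 2 * (\<Sum>r<d. (g r)\<^sup>2))
      + (real (Suc n))\<^sup>2 / 4 * (\<Sum>r<d. (g r)\<^sup>2)"
    by (intro add_right_mono diff_left_mono mult_left_mono 3) simp
  also have "\<dots> = (\<Sum>r<d. (z r)\<^sup>2) - (real (Suc n))\<^sup>2 / 4 * (\<Sum>r<d. (g r)\<^sup>2)"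
    by (simp add: power2_eq_square del: of_nat_Suc)
  finally have "(\<Sum>r<d. (g r)\<^sup>2) \<le> 4 * (\<Sum>r<d. (z r)\<^sup>2) / (real (Suc n))\<^sup>2"
    by (simp add: pos_le_divide_eq mult.commute[of _ "(real (Suc n))\<^sup>2"] del: of_nat_Suc)
  moreover have "(vec_norm (y n - T (y n)))\<^sup>2 = (\<Sum>r<d. (g r)\<^sup>2)"
    using carr[of n] Tc[OF carr[of n]] by (subst vec_norm_sq[of _ d]) (auto simp: g_def)
  moreover have "(vec_norm (y 0 - s))\<^sup>2 = (\<Sum>r<d. (z r)\<^sup>2)"
    using carr[of 0] s by (subst vec_norm_sq[of _ d]) (auto simp: z_def)
  ultimately show "(vec_norm (y (Suc n - 1) - T (y (Suc n - 1))))\<^sup>2 \<le> 4 * (vec_norm (y 0 - s))\<^sup>2 / (real (Suc n))\<^sup>2"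
    by simp
qed

text \<open>The rate for the fixed point \<open>0\<close>, with vectors as sequences of which the
  first \<open>d\<close> entries count. In this form it is tested on the worst-case
  operators.\<close>

lemma achieves_optimal_rateD:
  fixes T :: "(nat \<Rightarrow> real) \<Rightarrow> nat \<Rightarrow> real"
  assumes rate: "achieves_optimal_rate (Suc n) H" and "1 \<le> d"
    and T: "\<And>v w. (\<Sum>r<d. (T v r - T w r)\<^sup>2) \<le> (\<Sum>r<d. (v r - w r)\<^sup>2)"
    and zero: "\<And>r. r < d \<Longrightarrow> T (\<lambda>_. 0) r = 0"
    and step: "\<And>k r. k < n \<Longrightarrow> r < d \<Longrightarrow> x (Suc k) r = x k r - (\<Sum>j\<le>k. H $$ (k, j) * (x j r - T (x j) r))"
  shows "(\<Sum>r<d. (x n r - T (x n) r)\<^sup>2) \<le> 4 * (\<Sum>r<d. (x 0 r)\<^sup>2) / (real (Suc n))\<^sup>2"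
proof -
  \<comment> \<open>Nonexpansiveness itself makes the output depend on the first \<open>d\<close>
    entries only, so the unspecified values of \<open>v $ r\<close> beyond the dimension cannot
    affect \<open>T'\<close>.\<close>
  have cong: "T v r = T w r" if "\<And>r. r < d \<Longrightarrow> v r = w r" "r < d" for v w r
  proof -
    have "(\<Sum>r<d. (T v r - T w r)\<^sup>2) \<le> 0"
      using T[of v w] that(1) by simp
    then have "(\<Sum>r<d. (T v r - T w r)\<^sup>2) = 0"
      by (intro antisym sum_nonneg) auto
    then show ?thesis
      using that(2) by (simp add: sum_nonneg_eq_0_iff)
  qed
  define T' where "T' v = vec d (T (\<lambda>r. v $ r))" for v
  define y where "y k = vec d (x k)" for k
  have T'y: "T' (y k) $ r = T (x k) r" if "r < d" for k r
    using that by (auto simp: T'_def y_def intro: cong)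
  have carr: "T' v \<in> carrier_vec d" "y k \<in> carrier_vec d" for v k
    by (simp_all add: T'_def y_def)
  have "nonexpansive d T'"
    unfolding nonexpansive_def
  proof (intro conjI ballI)
    show "T' \<in> carrier_vec d \<rightarrow> carrier_vec d"
      by (simp add: carr)
    fix v w :: "real vec"
    assume vw: "v \<in> carrier_vec d" "w \<in> carrier_vec d"
    have "(vec_norm (T' v - T' w))\<^sup>2 = (\<Sum>r<d. (T (\<lambda>r. v $ r) r - T (\<lambda>r. w $ r) r)\<^sup>2)"
      using carr by (subst vec_norm_sq[of _ d]) (auto simp: T'_def)
    also have "\<dots> \<le> (\<Sum>r<d. (v $ r - w $ r)\<^sup>2)"
      by (rule T)
    also have "\<dots> = (vec_norm (v - w))\<^sup>2"
      using vw by (subst vec_norm_sq[of _ d]) auto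
    finally show "vec_norm (T' v - T' w) \<le> vec_norm (v - w)"
      by (rule power2_le_imp_le) (auto simp: vec_norm_def scalar_prod_def intro!: sum_nonneg)
  qed
  moreover have "T' (0\<^sub>v d) = 0\<^sub>v d"
  proof
    fix r assume "r < dim_vec (0\<^sub>v d :: real vec)"
    then show "T' (0\<^sub>v d) $ r = 0\<^sub>v d $ r"
      using cong[of "\<lambda>r. 0\<^sub>v d $ r" "\<lambda>_. 0" r] zero[of r] by (simp add: T'_def)
  qed (simp add: T'_def)
  moreover have "generates (Suc n) H d T' y"
    unfolding generates_def
  proof (intro conjI allI impI)
    fix k assume k: "k < Suc n - 1"
    let ?f = "\<lambda>j. H_entry H (k + 1) (j + 1) \<cdot>\<^sub>v (y j - T' (y j))"
    have f: "?f \<in> {0..k} \<rightarrow> carrier_vec d"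
      using carr by auto
    show "y (k + 1) = y k - finsum_vec TYPE(real) d ?f {0..k}"
    proof
      fix r assume "r < dim_vec (y k - finsum_vec TYPE(real) d ?f {0..k})"
      then have r: "r < d" using finsum_vec_closed[OF f] by simp
      then have "(y k - finsum_vec TYPE(real) d ?f {0..k}) $ r = y k $ r - (\<Sum>j\<in>{0..k}. ?f j $ r)"
        using f finsum_vec_closed[OF f] by (simp add: index_finsum_vec)
      also have "(\<Sum>j\<in>{0..k}. ?f j $ r) = (\<Sum>j\<le>k. H $$ (k, j) * (x j r - T (x j) r))"
      proof (intro sum.cong)
        fix j
        have "T' (y j) \<in> carrier_vec d" "y j $ r = x j r"
          using r by (simp_all add: T'_def y_def)
        then show "?f j $ r = H $$ (k, j) * (x j r - T (x j) r)"
          using r T'y[OF r, of j] by simp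
      qed auto
      finally show "y (k + 1) $ r = (y k - finsum_vec TYPE(real) d ?f {0..k}) $ r"
        using step[of k r] k r by (simp add: y_def)
    qed (use finsum_vec_closed[OF f] in \<open>simp add: y_def\<close>)
  qed (rule carr)
  ultimately have "(vec_norm (y n - T' (y n)))\<^sup>2 \<le> 4 * (vec_norm (y 0 - 0\<^sub>v d))\<^sup>2 / (real (Suc n))\<^sup>2"
    using rate[unfolded achieves_optimal_rate_def, rule_format, of d T' "0\<^sub>v d" y] \<open>1 \<le> d\<close> by simp
  moreover have "(vec_norm (y n - T' (y n)))\<^sup>2 = (\<Sum>r<d. (x n r - T (x n) r)\<^sup>2)"
  proof -
    have "(y n - T' (y n)) $ r = x n r - T (x n) r" if "r < d" for r
      using that T'y[OF that, of n] by (simp add: T'_def y_def)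
    then show ?thesis
      using carr by (subst vec_norm_sq[of _ d]) auto
  qed
  moreover have "(vec_norm (y 0 - 0\<^sub>v d))\<^sup>2 = (\<Sum>r<d. (x 0 r)\<^sup>2)"
    by (subst vec_norm_sq[of _ d]) (auto simp: y_def)
  ultimately show ?thesis by simp
qed

subsection \<open>The negacyclic shift\<close>

text \<open>On the first \<open>N\<close> coordinates this is a linear isometry whose
  \<open>N\<close>-th power is \<open>-1\<close>, so \<open>0\<close> is its only fixed point
  there.\<close>

definition negashift :: "nat \<Rightarrow> (nat \<Rightarrow> real) \<Rightarrow> nat \<Rightarrow> real" where
  "negashift N v r = (if r = 0 then - v (N - 1) else v (r - 1))"

definition resid :: "nat \<Rightarrow> (nat \<Rightarrow> real) \<Rightarrow> nat \<Rightarrow> real" where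
  "resid N v r = v r - negashift N v r"

lemma negashift_norm: "(\<Sum>r<Suc n. (negashift (Suc n) v r)\<^sup>2) = (\<Sum>r<Suc n. (v r)\<^sup>2)"
  by (subst sum.lessThan_Suc_shift) (simp add: negashift_def)

lemma negashift_lincomb: "negashift N (\<lambda>r. v r + c * w r) r = negashift N v r + c * negashift N w r"
  by (simp add: negashift_def)

lemma negashift_diff: "negashift N (\<lambda>r. v r - w r) r = negashift N v r - negashift N w r"
  by (simp add: negashift_def)

lemma resid_lincomb: "resid N (\<lambda>r. v r + c * w r) r = resid N v r + c * resid N w r"
  by (simp add: resid_def negashift_lincomb algebra_simps)

lemma resid_sum: "resid N (\<lambda>r. \<Sum>j\<in>J. c j * v j r) r = (\<Sum>j\<in>J. c j * resid N (v j) r)"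
  by (simp add: resid_def negashift_def sum_subtractf right_diff_distrib sum_negf sum.distrib)

lemma resid_cong:
  assumes "\<And>r. r \<le> n \<Longrightarrow> v r = w r" "r \<le> n"
  shows "resid (Suc n) v r = resid (Suc n) w r"
  using assms by (simp add: resid_def negashift_def)

text \<open>With \<open>A = resid (n + 1)\<close>, these are the vectors \<open>A\<^sup>t\<^sup>+\<^sup>1 (1, \<dots>, 1)\<close> for \<open>t \<le> n\<close>.\<close>

definition altbinom :: "nat \<Rightarrow> nat \<Rightarrow> real" where
  "altbinom t r = 2 * (- 1) ^ r * real (t choose r)"

lemma resid_one: "resid N (\<lambda>_. c) r = c * altbinom 0 r"
  by (auto simp: resid_def negashift_def altbinom_def)

text \<open>Pascal's rule with alternating signs; \<open>t < n\<close> makes the entry that wraps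
  around zero.\<close>

lemma resid_altbinom: "t < n \<Longrightarrow> resid (Suc n) (altbinom t) r = altbinom (Suc t) r"
  by (cases r) (auto simp: resid_def negashift_def altbinom_def algebra_simps)

text \<open>The residual map may depend on the step, so that an impulse can be injected at a single
  step later on.\<close>

fun iterates :: "(nat \<Rightarrow> nat \<Rightarrow> real) \<Rightarrow> (nat \<Rightarrow> (nat \<Rightarrow> real) \<Rightarrow> nat \<Rightarrow> real) \<Rightarrow> (nat \<Rightarrow> real) \<Rightarrow> nat \<Rightarrow> nat \<Rightarrow> real" where
  "iterates a G v 0 = v"
| "iterates a G v (Suc k) = (\<lambda>r. iterates a G v k r - (\<Sum>j\<le>k. a k j * G j (iterates a G v j) r))"

definition base_iterates :: "(nat \<Rightarrow> nat \<Rightarrow> real) \<Rightarrow> nat \<Rightarrow> nat \<Rightarrow> nat \<Rightarrow> real" where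
  "base_iterates a N = iterates a (\<lambda>_. resid N) (\<lambda>_. 1)"

lemma base_iterates_0: "base_iterates a N 0 r = 1"
  and base_iterates_Suc: "base_iterates a N (Suc k) r
    = base_iterates a N k r - (\<Sum>j\<le>k. a k j * resid N (base_iterates a N j) r)"
  by (simp_all add: base_iterates_def)

text \<open>Applying \<open>A = resid (n + 1)\<close> to \<open>chain_weight_abel\<close> expresses
  the weighted residual for \<open>m\<close> by the one for \<open>m + 1\<close>; unrolling stops at
  \<open>n + 1\<close>, where the weights vanish. For \<open>m = 0\<close> the last residual becomes
  a polynomial in \<open>A\<close>, applied to the all-ones vector, whose coefficients are the
  signed H-invariants.\<close>

lemma base_resid_eq:
  assumes "m + d = Suc n" "r \<le> n"
  shows "(\<Sum>j\<le>n. chain_weight a n m j * resid (Suc n) (base_iterates a (Suc n) j) r)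
    = (\<Sum>t<d. (- 1) ^ t * (\<Sum>j\<le>n. chain_weight a n (m + t) j) * altbinom t r)"
  using assms
proof (induction d arbitrary: m r)
  case 0
  then show ?case
    by (auto intro!: sum.neutral simp: chain_weight_eq_0 simp del: chain_weight.simps)
next
  case (Suc d)
  let ?x = "base_iterates a (Suc n)" and ?A = "resid (Suc n)" and ?S = "\<lambda>m. \<Sum>j\<le>n. chain_weight a n m j"
  have abel: "(\<Sum>j\<le>n. chain_weight a n m j * ?x j s)
      = ?S m + (- 1) * (\<Sum>j\<le>n. chain_weight a n (Suc m) j * ?A (?x j) s)" for s
    using chain_weight_abel[of n "\<lambda>k. ?x k s" a "\<lambda>k. ?A (?x k) s" m]
    by (simp add: base_iterates_0 base_iterates_Suc del: chain_weight.simps)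
  have "(\<Sum>j\<le>n. chain_weight a n m j * ?A (?x j) r) = ?A (\<lambda>s. \<Sum>j\<le>n. chain_weight a n m j * ?x j s) r"
    by (rule resid_sum[symmetric])
  also have "\<dots> = ?S m * altbinom 0 r - ?A (\<lambda>s. \<Sum>j\<le>n. chain_weight a n (Suc m) j * ?A (?x j) s) r"
    unfolding abel resid_lincomb resid_one by simp
  also have "?A (\<lambda>s. \<Sum>j\<le>n. chain_weight a n (Suc m) j * ?A (?x j) s) r
      = ?A (\<lambda>s. \<Sum>t<d. (- 1) ^ t * ?S (Suc m + t) * altbinom t s) r"
    using Suc.prems by (intro resid_cong Suc.IH) auto
  also have "\<dots> = (\<Sum>t<d. (- 1) ^ t * ?S (Suc m + t) * altbinom (Suc t) r)"
    unfolding resid_sum using Suc.prems by (intro sum.cong refl) (simp add: resid_altbinom del: chain_weight.simps)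
  also have "?S m * altbinom 0 r - \<dots> = (\<Sum>t<Suc d. (- 1) ^ t * ?S (m + t) * altbinom t r)"
    by (subst sum.lessThan_Suc_shift) (simp add: sum_negf del: chain_weight.simps)
  finally show ?case .
qed

lemma sum_altbinom: "t \<le> n \<Longrightarrow> (\<Sum>r\<le>n. altbinom t r) = (if t = 0 then 2 else 0)"
proof -
  assume "t \<le> n"
  then have "(\<Sum>r\<le>n. altbinom t r) = (\<Sum>r\<le>t. altbinom t r)"
    by (intro sum.mono_neutral_right) (auto simp: altbinom_def)
  also have "\<dots> = 2 * (\<Sum>r\<le>t. (- 1) ^ r * real (t choose r))"
    by (simp add: altbinom_def sum_distrib_left mult_ac)
  finally show ?thesis
    using alternating_sum_choose_mult[of 0 t 0] by (cases t) auto
qed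

lemma rate_imp_optimal:
  assumes "achieves_optimal_rate (Suc n) H"
  defines "a \<equiv> \<lambda>i j. H $$ (i, j)"
  shows "\<And>r. r \<le> n \<Longrightarrow> resid (Suc n) (base_iterates a (Suc n) n) r = 2 / real (Suc n)"
    and "\<And>m. m \<le> n \<Longrightarrow> (\<Sum>j\<le>n. chain_weight a n m j) = real (Suc n choose Suc m) / real (Suc n)"
proof -
  let ?x = "base_iterates a (Suc n)" and ?S = "\<lambda>m. \<Sum>j\<le>n. chain_weight a n m j" and ?N = "real (Suc n)"
  define g where "g = resid (Suc n) (?x n)"
  have S0: "?S 0 = 1" by simp
  have "(\<Sum>j\<le>n. chain_weight a n 0 j * resid (Suc n) (?x j) r) = g r" for r
    by (simp add: g_def if_distrib[of "\<lambda>u. u * _"] cong: if_cong)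
  then have g: "g r = (\<Sum>t\<le>n. (- 1) ^ t * ?S t * altbinom t r)" if "r \<le> n" for r
    using base_resid_eq[of 0 "Suc n" n r a] that by (simp add: lessThan_Suc_atMost del: chain_weight.simps)
  have "(\<Sum>r\<le>n. g r) = (\<Sum>r\<le>n. \<Sum>t\<le>n. (- 1) ^ t * ?S t * altbinom t r)"
    by (intro sum.cong refl g) simp
  also have "\<dots> = (\<Sum>t\<le>n. (- 1) ^ t * ?S t * (\<Sum>r\<le>n. altbinom t r))"
    unfolding sum_distrib_left by (rule sum.swap)
  also have "\<dots> = (\<Sum>t\<le>n. if t = 0 then 2 else 0)"
    by (intro sum.cong refl) (simp add: sum_altbinom)
  finally have sum_g: "(\<Sum>r\<le>n. g r) = 2" by simp
  have "(\<Sum>r<Suc n. (?x n r - negashift (Suc n) (?x n) r)\<^sup>2) \<le> 4 * (\<Sum>r<Suc n. (?x 0 r)\<^sup>2) / ?N\<^sup>2"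
  proof (rule achieves_optimal_rateD[OF assms(1)])
    show "(\<Sum>r<Suc n. (negashift (Suc n) v r - negashift (Suc n) w r)\<^sup>2) \<le> (\<Sum>r<Suc n. (v r - w r)\<^sup>2)" for v w
      using negashift_norm[of n "\<lambda>r. v r - w r"] unfolding negashift_diff by simp
  qed (auto simp: negashift_def base_iterates_Suc a_def resid_def)
  then have rate: "(\<Sum>r\<le>n. (g r)\<^sup>2) \<le> 4 / ?N"
    by (simp add: g_def resid_def base_iterates_0 lessThan_Suc_atMost power2_eq_square del: of_nat_Suc)
  \<comment> \<open>Entry sum \<open>2\<close> already forces squared norm at least
    \<open>4 / N\<close>, with the constant vector as unique minimiser; the squared distance to it
    is the excess over this minimum.\<close>
  have "(\<Sum>r\<le>n. (g r - 2 / ?N)\<^sup>2) = (\<Sum>r\<le>n. (g r)\<^sup>2 - 4 / ?N * g r + 4 / ?N\<^sup>2)"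
    by (intro sum.cong refl) (simp add: power2_eq_square algebra_simps del: of_nat_Suc)
  also have "\<dots> = (\<Sum>r\<le>n. (g r)\<^sup>2) - 4 / ?N * 2 + ?N * (4 / ?N\<^sup>2)"
    by (simp only: sum.distrib sum_subtractf sum_distrib_left[symmetric] sum_g) simp
  also have "\<dots> \<le> 0"
    using rate by (simp add: power2_eq_square del: of_nat_Suc)
  finally have "(\<Sum>r\<le>n. (g r - 2 / ?N)\<^sup>2) = 0"
    by (intro antisym sum_nonneg) auto
  then have g_eq: "g r = 2 / ?N" if "r \<le> n" for r
    using that by (simp add: sum_nonneg_eq_0_iff del: of_nat_Suc)
  then show "\<And>r. r \<le> n \<Longrightarrow> resid (Suc n) (?x n) r = 2 / ?N"
    by (simp add: g_def)
  show "?S m = real (Suc n choose Suc m) / ?N" if "m \<le> n" for m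
  proof -
    have "?S m = 1 / ?N * real (Suc n choose Suc m)"
    proof (rule alternating_choose_inversion[OF _ that])
      fix r assume r: "r \<le> n"
      have "g r = 2 * ((- 1) ^ r * (\<Sum>m\<le>n. (- 1) ^ m * ?S m * real (m choose r)))"
        unfolding g[OF r] altbinom_def sum_distrib_left by (intro sum.cong refl) (simp only: mult_ac)
      then show "(- 1) ^ r * (\<Sum>m\<le>n. (- 1) ^ m * ?S m * real (m choose r)) = 1 / ?N"
        using g_eq[OF r] by simp
    qed
    then show ?thesis by simp
  qed
qed

subsection \<open>Folded shifts\<close>

text \<open>A chain of maximal length needs one pair for every index from \<open>j\<close> on, which
  forces each pair onto the diagonal.\<close>

lemma chain_weight_diag:
  "m + j = n \<Longrightarrow> chain_weight a n m j = (\<Prod>i\<in>{j..<n}. a i i)"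
proof (induction m arbitrary: j)
  case 0
  then show ?case by simp
next
  case (Suc m)
  have "(\<Sum>k\<in>{i<..n}. chain_weight a n m k) = (if i = j then chain_weight a n m (Suc j) else 0)"
    if i: "i \<in> {j..<n}" for i
  proof (cases "i = j")
    case True
    have "(\<Sum>k\<in>{i<..n}. chain_weight a n m k) = (\<Sum>k\<in>{Suc j}. chain_weight a n m k)"
      using Suc.prems True by (intro sum.mono_neutral_right) (auto intro!: chain_weight_eq_0)
    then show ?thesis using True by simp
  next
    case False
    then show ?thesis
      using i Suc.prems by (auto intro!: sum.neutral chain_weight_eq_0)
  qed
  then have "chain_weight a n (Suc m) j = (\<Sum>i\<in>{j..<n}. if i = j then a j j * chain_weight a n m (Suc j) else 0)"
    unfolding chain_weight.simps by (intro sum.cong refl) auto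
  also have "\<dots> = a j j * chain_weight a n m (Suc j)"
    using Suc.prems by simp
  also have "\<dots> = (\<Prod>i\<in>{j..<n}. a i i)"
    using Suc.IH[of "Suc j"] Suc.prems by (simp add: prod.atLeast_Suc_lessThan[of j n] del: chain_weight.simps)
  finally show ?case .
qed

text \<open>The top H-invariant is the product of the diagonal, and its optimal value is
  nonzero.\<close>

lemma diag_nonzero:
  assumes "(\<Sum>j\<le>n. chain_weight a n n j) \<noteq> 0" "i < n"
  shows "a i i \<noteq> 0"
proof -
  have "(\<Sum>j\<le>n. chain_weight a n n j) = (\<Sum>j\<in>{0}. chain_weight a n n j)"
    by (intro sum.mono_neutral_right) (auto intro!: chain_weight_eq_0)
  also have "\<dots> = (\<Prod>i<n. a i i)"
    by (simp add: chain_weight_diag atLeast0LessThan del: chain_weight.simps)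
  finally show ?thesis using assms by auto
qed

text \<open>The shift carries information one coordinate further per step, so \<open>k\<close> steps
  can disturb only the first \<open>k\<close> ones.\<close>

lemma base_iterates_eq_1: "k \<le> r \<Longrightarrow> base_iterates a N k r = 1"
proof (induction k arbitrary: r rule: less_induct)
  case (less k)
  show ?case
  proof (cases k)
    case 0
    then show ?thesis by (simp add: base_iterates_0)
  next
    case (Suc k')
    have "resid N (base_iterates a N j) r = 0" if "j \<le> k'" for j
      using that less.prems Suc less.IH[of j r] less.IH[of j "r - 1"] by (simp add: resid_def negashift_def)
    then show ?thesis
      using less.prems Suc less.IH[of k' r] by (simp add: base_iterates_Suc)
  qed
qed

text \<open>Coordinate \<open>k\<close> is first disturbed at step \<open>k + 1\<close>, by
  \<open>a k k\<close> times the disturbance that coordinate \<open>k - 1\<close> received one step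
  earlier.\<close>

lemma base_iterates_neq_1:
  assumes "\<And>i. i < n \<Longrightarrow> a i i \<noteq> 0" "k < n"
  shows "base_iterates a N (Suc k) k \<noteq> 1"
  using assms(2)
proof (induction k)
  case 0
  have "base_iterates a N (Suc 0) 0 = 1 - a 0 0 * 2"
    by (simp add: base_iterates_Suc base_iterates_0 resid_def negashift_def)
  then show ?case using assms(1)[of 0] 0 by simp
next
  case (Suc k)
  have "resid N (base_iterates a N j) (Suc k) = 0" if "j \<le> k" for j
    using that by (simp add: resid_def negashift_def base_iterates_eq_1)
  then have "base_iterates a N (Suc (Suc k)) (Suc k) = 1 - a (Suc k) (Suc k) * (1 - base_iterates a N (Suc k) k)"
    by (subst base_iterates_Suc) (simp add: base_iterates_eq_1 resid_def negashift_def)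
  then show ?case using assms(1)[of "Suc k"] Suc by simp
qed

section \<open>Prescribed inner products with the iterates\<close>

definition ip :: "nat \<Rightarrow> (nat \<Rightarrow> real) \<Rightarrow> (nat \<Rightarrow> real) \<Rightarrow> real" where
  "ip N u v = (\<Sum>r<N. u r * v r)"

lemma ip_lincomb: "ip N u (\<lambda>r. v r + c * w r) = ip N u v + c * ip N u w"
  and ip_lincomb_left: "ip N (\<lambda>r. v r + c * w r) u = ip N v u + c * ip N w u"
  by (simp_all add: ip_def sum.distrib sum_distrib_left algebra_simps)

text \<open>The vectors \<open>1 - ?x k\<close> form a triangular system with nonzero diagonal, so
  the coordinates of \<open>u\<close> can be solved for one after another.\<close>

lemma exists_dual_vector:
  assumes diag: "\<And>i. i < n \<Longrightarrow> a i i \<noteq> 0"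
  shows "\<exists>u. \<forall>k\<le>n. ip (Suc n) u (base_iterates a (Suc n) k) = c k"
proof -
  let ?x = "base_iterates a (Suc n)"
  have "\<exists>u. \<forall>k\<le>m. (\<Sum>r<k. u r * (1 - ?x k r)) = c 0 - c k" if "m \<le> n" for m
    using that
  proof (induction m)
    case 0
    then show ?case by simp
  next
    case (Suc m)
    then obtain u where u: "(\<Sum>r<k. u r * (1 - ?x k r)) = c 0 - c k" if "k \<le> m" for k
      by auto
    have neq: "1 - ?x (Suc m) m \<noteq> 0"
      using base_iterates_neq_1[of n a m "Suc n"] diag Suc.prems by simp
    define u' where "u' = u(m := (c 0 - c (Suc m) - (\<Sum>r<m. u r * (1 - ?x (Suc m) r))) / (1 - ?x (Suc m) m))"
    have "(\<Sum>r<k. u' r * (1 - ?x k r)) = c 0 - c k" if "k \<le> Suc m" for k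
    proof (cases "k = Suc m")
      case True
      have "(\<Sum>r<m. u' r * (1 - ?x (Suc m) r)) = (\<Sum>r<m. u r * (1 - ?x (Suc m) r))"
        by (intro sum.cong) (auto simp: u'_def)
      then show ?thesis using neq True by (simp add: u'_def)
    next
      case False
      have "(\<Sum>r<k. u' r * (1 - ?x k r)) = (\<Sum>r<k. u r * (1 - ?x k r))"
        using that False by (intro sum.cong) (auto simp: u'_def)
      then show ?thesis using u[of k] that False by simp
    qed
    then show ?case by blast
  qed
  from this[of n] obtain u where u: "(\<Sum>r<k. u r * (1 - ?x k r)) = c 0 - c k" if "k \<le> n" for k
    by auto
  \<comment> \<open>Every \<open>?x k\<close> with \<open>k \<le> n\<close> has last coordinate
    \<open>1\<close>, so the last entry of \<open>u\<close> stays free in the triangular system and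
    can adjust the total to \<open>c 0\<close>.\<close>
  define u' where "u' = u(n := c 0 - (\<Sum>r<n. u r))"
  have "(\<Sum>r<n. u' r) = (\<Sum>r<n. u r)"
    by (intro sum.cong) (auto simp: u'_def)
  then have total: "(\<Sum>r<Suc n. u' r) = c 0"
    by (simp add: u'_def)
  have "ip (Suc n) u' (?x k) = c k" if "k \<le> n" for k
  proof -
    have "ip (Suc n) u' (?x k) = (\<Sum>r<Suc n. u' r) - (\<Sum>r<Suc n. u' r * (1 - ?x k r))"
      by (simp add: ip_def right_diff_distrib sum_subtractf)
    also have "(\<Sum>r<Suc n. u' r * (1 - ?x k r)) = (\<Sum>r<k. u' r * (1 - ?x k r))"
      using that by (intro sum.mono_neutral_right) (auto simp: base_iterates_eq_1)
    also have "\<dots> = (\<Sum>r<k. u r * (1 - ?x k r))"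
      using that by (intro sum.cong) (auto simp: u'_def)
    finally show ?thesis using total u[OF that] by simp
  qed
  then show ?thesis by blast
qed

text \<open>The identity where \<open>ip N u v \<ge> 0\<close>, and the reflection in the hyperplane
  orthogonal to \<open>u\<close> on the other side.\<close>

definition fold_map :: "nat \<Rightarrow> (nat \<Rightarrow> real) \<Rightarrow> (nat \<Rightarrow> real) \<Rightarrow> nat \<Rightarrow> real" where
  "fold_map N u v r = v r + 2 * max 0 (- ip N u v) / ip N u u * u r"

text \<open>Folding only replaces the component along \<open>u\<close> by its absolute value, so
  distance is lost in that component alone, and only between points strictly on opposite
  sides.\<close>

lemma fold_map_dist:
  assumes "ip N u u \<noteq> 0"
  shows "(\<Sum>r<N. (fold_map N u v r - fold_map N u w r)\<^sup>2)
    = (\<Sum>r<N. (v r - w r)\<^sup>2) - ((ip N u v - ip N u w)\<^sup>2 - (\<bar>ip N u v\<bar> - \<bar>ip N u w\<bar>)\<^sup>2) / ip N u u"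
proof -
  define p q U where "p = ip N u v" and "q = ip N u w" and "U = ip N u u"
  define s where "s = max 0 (- p) - max 0 (- q)"
  have s: "\<bar>p\<bar> - \<bar>q\<bar> = p - q + 2 * s"
    by (auto simp: s_def max_def)
  have diff: "fold_map N u v r - fold_map N u w r = (v r - w r) + 2 * s / U * u r" for r
    by (simp add: fold_map_def p_def q_def U_def s_def algebra_simps diff_divide_distrib)
  have "(\<Sum>r<N. (fold_map N u v r - fold_map N u w r)\<^sup>2)
      = (\<Sum>r<N. (v r - w r)\<^sup>2 + 4 * s / U * (u r * v r - u r * w r) + (2 * s / U)\<^sup>2 * (u r * u r))"
    unfolding diff by (intro sum.cong refl) (simp add: power2_eq_square algebra_simps)
  also have "\<dots> = (\<Sum>r<N. (v r - w r)\<^sup>2) + 4 * s / U * (p - q) + (2 * s / U)\<^sup>2 * U"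
    by (simp only: sum.distrib sum_distrib_left[symmetric] sum_subtractf p_def q_def U_def ip_def)
  also have "\<dots> = (\<Sum>r<N. (v r - w r)\<^sup>2) - ((p - q)\<^sup>2 - (p - q + 2 * s)\<^sup>2) / U"
    using assms by (simp add: U_def power2_eq_square field_simps)
  finally show ?thesis
    using s unfolding p_def q_def U_def by simp
qed

text \<open>
  The iterates of the folded shift are \<open>base_iterates + e * y\<close>: only \<open>x k0\<close> lies on the folded side, so all
  later iterates follow the linear recursion of the shift driven by the single impulse \<open>w\<close>.
\<close>

lemma certificate_perturbed_ge:
  fixes n :: nat and H :: "real mat" and u :: "nat \<Rightarrow> real"
  defines "a \<equiv> \<lambda>i j. H $$ (i, j)" and "N \<equiv> Suc n"
  assumes rate: "achieves_optimal_rate N H"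
    and j0: "j0 < k0" "k0 \<le> n" and e: "0 < e"
    and u_less: "\<And>k. k < k0 \<Longrightarrow> ip N u (base_iterates a N k) = (if k = j0 then 1 else 0)"
    and u_k0: "ip N u (base_iterates a N k0) = - e"
    and w: "\<And>r. w r = 2 / ip N u u * negashift N u r"
    and y: "y = iterates a (\<lambda>j v r. resid N v r - (if j = k0 then w r else 0)) (\<lambda>_. 0)"
    and pos: "\<And>k. k0 < k \<Longrightarrow> k \<le> n \<Longrightarrow> 0 \<le> ip N u (base_iterates a N k) + e * ip N u (y k)"
  shows "0 \<le> certificate a n k0 j0
    + (\<Sum>k\<in>{k0<..n}. certificate a n k k0 * (ip N u (base_iterates a N k) + e * ip N u (y k)))
    + e * (\<Sum>r<N. (resid N (y n) r - (if n = k0 then w r else 0))\<^sup>2) * real N * ip N u u / 8"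
proof -
  let ?x0 = "base_iterates a N"
  define U where "U = ip N u u"
  define x where "x k r = ?x0 k r + e * y k r" for k r
  define \<alpha> where "\<alpha> k = ip N u (x k)" for k
  define T where "T v = negashift N (fold_map N u v)" for v
  define g where "g k r = x k r - T (x k) r" for k r
  define \<gamma> where "\<gamma> r = resid N (y n) r - (if n = k0 then w r else 0)" for r
  have opt: "(\<Sum>j\<le>n. chain_weight a n m j) = real (Suc n choose Suc m) / real (Suc n)" if "m \<le> n" for m
    using rate_imp_optimal(2)[of n H m] rate that by (simp add: a_def N_def)
  have U: "0 < U"
  proof -
    have "U \<noteq> 0"
    proof
      assume "U = 0"
      then have "\<forall>r<N. u r = 0"
        by (simp add: U_def ip_def sum_nonneg_eq_0_iff)
      then have "ip N u (?x0 j0) = 0" by (simp add: ip_def)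
      then show False using u_less[of j0] j0 by simp
    qed
    moreover have "0 \<le> U" by (simp add: U_def ip_def sum_nonneg)
    ultimately show ?thesis by simp
  qed
  have y_Suc: "y (Suc k) r = y k r - (\<Sum>j\<le>k. a k j * (resid N (y j) r - (if j = k0 then w r else 0)))" for k r
    by (simp add: y)
  have y_0: "y k r = 0" if "k \<le> k0" for k r
    using that
  proof (induction k arbitrary: r rule: less_induct)
    case (less k)
    show ?case
    proof (cases k)
      case 0
      then show ?thesis by (simp add: y)
    next
      case (Suc k')
      have "resid N (y j) r = 0" if "j \<le> k'" for j
        using less that Suc by (simp add: resid_def negashift_def)
      then show ?thesis
        using less Suc by (simp add: y_Suc)
    qed
  qed
  have x_fun: "x k = (\<lambda>r. ?x0 k r + e * y k r)" for k
    by (auto simp: x_def)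
  have \<alpha>: "\<alpha> k = ip N u (?x0 k) + e * ip N u (y k)" for k
    by (simp add: \<alpha>_def x_fun ip_lincomb)
  have "ip N u (y k) = 0" if "k \<le> k0" for k
    using y_0[OF that] by (simp add: ip_def)
  then have \<alpha>_less: "\<alpha> k = (if k = j0 then 1 else 0)" if "k < k0" for k
    using that u_less by (simp add: \<alpha>)
  have \<alpha>_k0: "\<alpha> k0 = - e"
    using u_k0 \<open>\<And>k. k \<le> k0 \<Longrightarrow> ip N u (y k) = 0\<close> by (simp add: \<alpha>)
  have \<alpha>_greater: "0 \<le> \<alpha> k" if "k0 < k" "k \<le> n" for k
    using pos[OF that] by (simp add: \<alpha>)
  \<comment> \<open>Folding adds \<open>2 * e / U * u\<close> at step \<open>k0\<close> only. The
    shift turns this into \<open>e * w\<close>, which enters the residual with a minus sign.\<close>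
  have g: "g k r = resid N (?x0 k) r + e * (resid N (y k) r - (if k = k0 then w r else 0))" if "k \<le> n" for k r
  proof -
    have "max 0 (- \<alpha> k) = (if k = k0 then e else 0)"
      using \<alpha>_less[of k] \<alpha>_k0 \<alpha>_greater[of k] that e by (cases k k0 rule: linorder_cases) auto
    then have "fold_map N u (x k) = (\<lambda>r. x k r + (if k = k0 then 2 * e / U else 0) * u r)"
      unfolding fold_map_def by (auto simp: \<alpha>_def U_def)
    then have "T (x k) r = negashift N (?x0 k) r + e * negashift N (y k) r + (if k = k0 then 2 * e / U else 0) * negashift N u r"
      by (simp add: T_def negashift_lincomb x_fun)
    then show ?thesis
      by (simp add: g_def x_def resid_def w U_def algebra_simps)
  qed
  have T_dist: "(\<Sum>r<N. (T v r - T v' r)\<^sup>2)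
      = (\<Sum>r<N. (v r - v' r)\<^sup>2) - ((ip N u v - ip N u v')\<^sup>2 - (\<bar>ip N u v\<bar> - \<bar>ip N u v'\<bar>)\<^sup>2) / U" for v v'
  proof -
    have "(\<Sum>r<N. (T v r - T v' r)\<^sup>2) = (\<Sum>r<N. (fold_map N u v r - fold_map N u v' r)\<^sup>2)"
      using negashift_norm[of n "\<lambda>r. fold_map N u v r - fold_map N u v' r"]
      unfolding T_def N_def negashift_diff .
    then show ?thesis
      using fold_map_dist[of N u v v'] U unfolding U_def by simp
  qed
  have T_zero: "T (\<lambda>_. 0) r = 0" for r
    by (simp add: T_def negashift_def fold_map_def ip_def)
  have step: "x (Suc k) r = x k r - (\<Sum>j\<le>k. a k j * g j r)" if "k < n" for k r
  proof -
    have "(\<Sum>j\<le>k. a k j * g j r) = (\<Sum>j\<le>k. a k j * resid N (?x0 j) r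
        + e * (a k j * (resid N (y j) r - (if j = k0 then w r else 0))))"
      using that by (intro sum.cong refl) (simp add: g distrib_left)
    also have "\<dots> = (\<Sum>j\<le>k. a k j * resid N (?x0 j) r)
        + e * (\<Sum>j\<le>k. a k j * (resid N (y j) r - (if j = k0 then w r else 0)))"
      by (simp only: sum.distrib sum_distrib_left)
    finally show ?thesis
      by (simp add: x_def base_iterates_Suc y_Suc right_diff_distrib)
  qed
  \<comment> \<open>The unperturbed residual is the constant \<open>2 / N\<close> and attains the
    rate with equality. Hence the rate bounds the first-order change \<open>\<sigma>\<close> of the
    entry sum by a term of order \<open>e\<close>.\<close>
  define \<sigma> \<tau> where "\<sigma> = (\<Sum>r<N. \<gamma> r)" and "\<tau> = (\<Sum>r<N. (\<gamma> r)\<^sup>2)"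
  have gn: "g n r = 2 / real N + e * \<gamma> r" if "r < N" for r
    using g[of n r] rate_imp_optimal(1)[of n H r] rate that by (simp add: \<gamma>_def a_def N_def)
  have sum_g: "(\<Sum>r<N. g n r) = 2 + e * \<sigma>"
    by (simp add: gn sum.distrib \<sigma>_def flip: sum_distrib_left) (simp add: N_def del: of_nat_Suc)
  have sum_g2: "(\<Sum>r<N. (g n r)\<^sup>2) = 4 / real N + 4 / real N * e * \<sigma> + e\<^sup>2 * \<tau>"
  proof -
    have "(\<Sum>r<N. (g n r)\<^sup>2) = (\<Sum>r<N. 4 / (real N)\<^sup>2 + 4 / real N * e * \<gamma> r + e\<^sup>2 * (\<gamma> r)\<^sup>2)"
      by (intro sum.cong refl) (simp add: gn power2_eq_square algebra_simps)
    also have "\<dots> = real N * (4 / (real N)\<^sup>2) + 4 / real N * e * \<sigma> + e\<^sup>2 * \<tau>"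
      by (simp add: sum.distrib sum_distrib_left \<sigma>_def \<tau>_def)
    finally show ?thesis by (simp add: power2_eq_square N_def del: of_nat_Suc)
  qed
  have "(\<Sum>r<N. (x n r - T (x n) r)\<^sup>2) \<le> 4 * (\<Sum>r<N. (x 0 r)\<^sup>2) / (real (Suc n))\<^sup>2"
  proof (rule achieves_optimal_rateD[of n H N])
    fix v v' :: "nat \<Rightarrow> real"
    have "(\<bar>ip N u v\<bar> - \<bar>ip N u v'\<bar>)\<^sup>2 \<le> (ip N u v - ip N u v')\<^sup>2"
      by (simp add: abs_le_square_iff[symmetric])
    then show "(\<Sum>r<N. (T v r - T v' r)\<^sup>2) \<le> (\<Sum>r<N. (v r - v' r)\<^sup>2)"
      using U by (simp add: T_dist)
  qed (use rate step T_zero in \<open>auto simp: N_def a_def g_def\<close>)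
  then have "(\<Sum>r<N. (g n r)\<^sup>2) \<le> 4 * (\<Sum>r<N. (x 0 r)\<^sup>2) / (real (Suc n))\<^sup>2"
    unfolding g_def .
  then have "(\<Sum>r<N. (g n r)\<^sup>2) \<le> 4 / real N"
    by (simp add: x_def base_iterates_0 y_0 N_def power2_eq_square del: of_nat_Suc sum.lessThan_Suc)
  then have "e * (4 / real N * \<sigma> + e * \<tau>) \<le> 0"
    unfolding sum_g2 by (simp add: power2_eq_square distrib_left mult_ac)
  then have "4 / real N * \<sigma> + e * \<tau> \<le> 0"
    using e by (simp add: mult_le_0_iff)
  then have \<sigma>_le: "\<sigma> \<le> - (real N * e * \<tau> / 4)"
    by (simp add: field_simps N_def del: of_nat_Suc)
  \<comment> \<open>\<open>L\<close> collects the pairs whose distance shrinks: \<open>k0\<close>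
    with \<open>j0\<close>, and \<open>k0\<close> with the later iterates. All other pairs lie on
    one closed side of the hyperplane.\<close>
  define L where "L = certificate a n k0 j0 + (\<Sum>k\<in>{k0<..n}. certificate a n k k0 * \<alpha> k)"
  have "(\<Sum>k\<le>n. \<Sum>j<k. certificate a n k j *
      ((\<Sum>r<N. (x k r - x j r)\<^sup>2) - (\<Sum>r<N. ((x k r - g k r) - (x j r - g j r))\<^sup>2))) / 2
      = (\<Sum>r<N. (x 0 r - x n r) * g n r) - real n / 2 * (\<Sum>r<N. (g n r)\<^sup>2)"
    by (rule certificate_identity_vec[OF step opt])
  moreover have "(\<Sum>k\<le>n. \<Sum>j<k. certificate a n k j *
      ((\<Sum>r<N. (x k r - x j r)\<^sup>2) - (\<Sum>r<N. ((x k r - g k r) - (x j r - g j r))\<^sup>2))) = 4 * e / U * L"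
  proof -
    have D: "(\<Sum>r<N. (x k r - x j r)\<^sup>2) - (\<Sum>r<N. ((x k r - g k r) - (x j r - g j r))\<^sup>2)
        = 4 * e / U * ((if k = k0 then (if j = j0 then 1 else 0) else 0) + (if j = k0 then \<alpha> k else 0))"
      if "k \<le> n" "j < k" for k j
    proof -
      have "(\<Sum>r<N. (x k r - x j r)\<^sup>2) - (\<Sum>r<N. ((x k r - g k r) - (x j r - g j r))\<^sup>2)
          = ((\<alpha> k - \<alpha> j)\<^sup>2 - (\<bar>\<alpha> k\<bar> - \<bar>\<alpha> j\<bar>)\<^sup>2) / U"
        using T_dist[of "x k" "x j"] by (simp add: g_def \<alpha>_def)
      moreover have "(\<alpha> k - \<alpha> j)\<^sup>2 - (\<bar>\<alpha> k\<bar> - \<bar>\<alpha> j\<bar>)\<^sup>2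
          = 4 * e * ((if k = k0 then (if j = j0 then 1 else 0) else 0) + (if j = k0 then \<alpha> k else 0))"
      proof (cases k k0 rule: linorder_cases)
        case less
        then show ?thesis using that by (simp add: \<alpha>_less)
      next
        case equal
        then show ?thesis using that e by (simp add: \<alpha>_less \<alpha>_k0 power2_eq_square algebra_simps)
      next
        case greater
        then have k: "0 \<le> \<alpha> k" using \<alpha>_greater that by simp
        show ?thesis
        proof (cases "j = k0")
          case True
          then show ?thesis using greater k e by (simp add: \<alpha>_k0 power2_eq_square algebra_simps)
        next
          case False
          then have "0 \<le> \<alpha> j" using \<alpha>_less[of j] \<alpha>_greater[of j] that by (cases j k0 rule: linorder_cases) auto
          then show ?thesis using greater k False by simp
        qed
      qed
      ultimately show ?thesis by simp
    qed
    have "(\<Sum>k\<le>n. \<Sum>j<k. certificate a n k j *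
        ((\<Sum>r<N. (x k r - x j r)\<^sup>2) - (\<Sum>r<N. ((x k r - g k r) - (x j r - g j r))\<^sup>2)))
      = (\<Sum>k\<le>n. \<Sum>j<k. 4 * e / U * ((if j = j0 then (if k = k0 then certificate a n k j else 0) else 0)
          + (if j = k0 then certificate a n k j * \<alpha> k else 0)))"
      by (intro sum.cong refl) (simp add: D)
    also have "\<dots> = 4 * e / U * ((\<Sum>k\<le>n. \<Sum>j<k. if j = j0 then (if k = k0 then certificate a n k j else 0) else 0)
          + (\<Sum>k\<le>n. \<Sum>j<k. if j = k0 then certificate a n k j * \<alpha> k else 0))"
      by (simp only: sum.distrib sum_distrib_left distrib_left)
    also have "(\<Sum>k\<le>n. \<Sum>j<k. if j = j0 then (if k = k0 then certificate a n k j else 0) else 0)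
        = (\<Sum>k\<le>n. if k = k0 then certificate a n k0 j0 else 0)"
      using j0 by (intro sum.cong refl) auto
    also have "\<dots> = certificate a n k0 j0"
      using j0 by simp
    also have "(\<Sum>k\<le>n. \<Sum>j<k. if j = k0 then certificate a n k j * \<alpha> k else 0)
        = (\<Sum>k\<le>n. if k0 < k then certificate a n k k0 * \<alpha> k else 0)"
      by (intro sum.cong refl) auto
    also have "\<dots> = (\<Sum>k\<in>{k0<..n}. certificate a n k k0 * \<alpha> k)"
      by (simp add: sum.If_cases) (rule sum.cong, auto)
    finally show ?thesis unfolding L_def .
  qed
  \<comment> \<open>\<open>T\<close> preserves norms because the fold and the shift do, which
    evaluates the inner product of \<open>x n\<close> with \<open>g n\<close>; and
    \<open>x 0\<close> is the all-ones vector.\<close>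
  moreover have "(\<Sum>r<N. (x 0 r - x n r) * g n r) = (\<Sum>r<N. g n r) - (\<Sum>r<N. (g n r)\<^sup>2) / 2"
  proof -
    have "(\<Sum>r<N. (T (x n) r)\<^sup>2) = (\<Sum>r<N. (x n r)\<^sup>2)"
      using T_dist[of "x n" "\<lambda>_. 0"] by (simp add: T_zero) (simp add: ip_def)
    then have "0 = (\<Sum>r<N. (x n r)\<^sup>2 - (T (x n) r)\<^sup>2)"
      by (simp add: sum_subtractf)
    also have "\<dots> = (\<Sum>r<N. 2 * (x n r * g n r) - (g n r)\<^sup>2)"
      by (intro sum.cong refl) (simp add: g_def power2_eq_square algebra_simps)
    also have "\<dots> = 2 * (\<Sum>r<N. x n r * g n r) - (\<Sum>r<N. (g n r)\<^sup>2)"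
      by (simp add: sum_subtractf sum_distrib_left)
    finally have "(\<Sum>r<N. x n r * g n r) = (\<Sum>r<N. (g n r)\<^sup>2) / 2" by simp
    moreover have "(\<Sum>r<N. (x 0 r - x n r) * g n r) = (\<Sum>r<N. g n r) - (\<Sum>r<N. x n r * g n r)"
      by (simp add: x_def base_iterates_0 y_0 left_diff_distrib sum_subtractf)
    ultimately show ?thesis by simp
  qed
  ultimately have "(4 * e / U * L) / 2
      = (\<Sum>r<N. g n r) - (\<Sum>r<N. (g n r)\<^sup>2) / 2 - real n / 2 * (\<Sum>r<N. (g n r)\<^sup>2)"
    by (simp only:)
  moreover have "2 * e / U * L = (4 * e / U * L) / 2"
    by simp
  moreover have "real N / 2 * t = t / 2 + real n / 2 * t" for t
    by (simp add: N_def add_divide_distrib distrib_right)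
  ultimately have "2 * e / U * L = (\<Sum>r<N. g n r) - real N / 2 * (\<Sum>r<N. (g n r)\<^sup>2)"
    by (simp only: diff_diff_eq)
  also have "\<dots> = (2 + e * \<sigma>) - real N / 2 * (4 / real N + 4 / real N * e * \<sigma> + e\<^sup>2 * \<tau>)"
    by (simp only: sum_g sum_g2)
  \<comment> \<open>The terms free of \<open>e\<close> cancel, so a factor \<open>e\<close> can be
    divided out on both sides and the certificate survives at order zero.\<close>
  also have "\<dots> = e * (- \<sigma> - real N / 2 * e * \<tau>)"
    by (simp add: N_def power2_eq_square algebra_simps del: of_nat_Suc)
  finally have "e * (2 / U * L) = e * (- \<sigma> - real N / 2 * e * \<tau>)"
    by (simp only: mult.assoc[symmetric] times_divide_eq_right mult.commute[of e 2])
  then have "2 / U * L = - \<sigma> - real N / 2 * e * \<tau>"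
    using e by (simp only: mult_cancel_left) simp
  then have "- (real N * e * \<tau> / 4) \<le> 2 / U * L"
    using \<sigma>_le by simp
  then have "0 \<le> L + e * \<tau> * real N * U / 8"
    using U by (simp add: field_simps)
  then show ?thesis
    unfolding L_def \<alpha> \<tau>_def \<gamma>_def U_def .
qed

section \<open>The limit of vanishing perturbation\<close>

lemma negashift_tendsto:
  assumes "\<And>r. ((\<lambda>e. v e r) \<longlongrightarrow> v' r) F"
  shows "((\<lambda>e. negashift N (v e) r) \<longlongrightarrow> negashift N v' r) F"
  using assms by (cases r) (auto simp: negashift_def intro!: tendsto_intros)

lemma resid_tendsto:
  assumes "\<And>r. ((\<lambda>e. v e r) \<longlongrightarrow> v' r) F"
  shows "((\<lambda>e. resid N (v e) r) \<longlongrightarrow> resid N v' r) F"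
  unfolding resid_def by (intro tendsto_intros negashift_tendsto assms)

lemma ip_tendsto:
  assumes "\<And>r. ((\<lambda>e. v e r) \<longlongrightarrow> v' r) F" "\<And>r. ((\<lambda>e. w e r) \<longlongrightarrow> w' r) F"
  shows "((\<lambda>e. ip N (v e) (w e)) \<longlongrightarrow> ip N v' w') F"
  unfolding ip_def by (intro tendsto_intros assms)

lemma iterates_tendsto:
  assumes "\<And>r. ((\<lambda>e. w e r) \<longlongrightarrow> w' r) F"
  shows "((\<lambda>e. iterates a (\<lambda>j v r. resid N v r - (if j = i then w e r else 0)) (\<lambda>_. 0) k r)
    \<longlongrightarrow> iterates a (\<lambda>j v r. resid N v r - (if j = i then w' r else 0)) (\<lambda>_. 0) k r) F"
proof (induction k arbitrary: r rule: less_induct)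
  case (less k)
  have if_tendsto: "((\<lambda>e. if j = i then w e r else 0) \<longlongrightarrow> (if j = i then w' r else 0)) F" for j
    using assms by simp
  show ?case
  proof (cases k)
    case 0
    then show ?thesis by simp
  next
    case (Suc k')
    show ?thesis
      unfolding Suc iterates.simps
      by (intro tendsto_diff tendsto_sum tendsto_mult tendsto_const resid_tendsto less.IH if_tendsto)
         (auto simp: Suc)
  qed
qed

text \<open>The normal \<open>uA + e * uB\<close> separates \<open>x k0\<close> from
  \<open>x j0\<close> by signs \<open>- e\<close> and \<open>1\<close>. The other certificates in
  the perturbed inequality carry factors of order \<open>e\<close>, so the chosen one remains in the
  limit.\<close>

lemma rate_imp_certificate_nonneg:
  assumes rate: "achieves_optimal_rate (Suc n) H" and j0: "j0 < k0" "k0 \<le> n"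
  shows "0 \<le> certificate (\<lambda>i j. H $$ (i, j)) n k0 j0"
proof -
  let ?a = "\<lambda>i j. H $$ (i, j)" and ?N = "Suc n"
  let ?x0 = "base_iterates ?a ?N" and ?F = "at_right (0::real)"
  define w where "w u r = 2 / ip ?N u u * negashift ?N u r" for u r
  define y where "y u = iterates ?a (\<lambda>j v r. resid ?N v r - (if j = k0 then w u r else 0)) (\<lambda>_. 0)" for u
  have diag: "?a i i \<noteq> 0" if "i < n" for i
    by (rule diag_nonzero[OF _ that]) (simp add: rate_imp_optimal(2)[OF rate] del: chain_weight.simps)
  obtain uA where uA: "ip ?N uA (?x0 k) = (if k = j0 then 1 else 0)" if "k \<le> n" for k
    using exists_dual_vector[of n ?a "\<lambda>k. if k = j0 then 1 else 0"] diag by auto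
  txt \<open>\<open>K\<close> keeps the iterates after \<open>k0\<close> on the unfolded side in spite of the impulse.\<close>
  define K where "K = 1 + (\<Sum>k\<le>n. \<bar>ip ?N uA (y uA k)\<bar>)"
  \<comment> \<open>Adding \<open>e * uB\<close> leaves the inner products of the iterates before
    \<open>k0\<close> alone, moves that of \<open>k0\<close> to \<open>- e\<close>, and gives later
    ones the margin \<open>e * K\<close>.\<close>
  obtain uB where uB: "ip ?N uB (?x0 k) = (if k < k0 then 0 else if k = k0 then - 1 else K)" if "k \<le> n" for k
    using exists_dual_vector[of n ?a "\<lambda>k. if k < k0 then 0 else if k = k0 then - 1 else K"] diag by auto
  define u where "u e r = uA r + e * uB r" for e r
  have UA: "ip ?N uA uA \<noteq> 0"
  proof
    assume "ip ?N uA uA = 0"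
    then have "\<forall>r<?N. uA r = 0"
      unfolding ip_def by (simp add: sum_nonneg_eq_0_iff del: sum.lessThan_Suc)
    then have "ip ?N uA (?x0 j0) = 0" by (simp add: ip_def)
    then show False using uA[of j0] j0 by simp
  qed
  have u_tendsto: "((\<lambda>e. u e r) \<longlongrightarrow> uA r) ?F" for r
    unfolding u_def by (auto intro!: tendsto_eq_intros)
  note U_tendsto = ip_tendsto[OF u_tendsto u_tendsto, of ?N]
  have w_tendsto: "((\<lambda>e. w (u e) r) \<longlongrightarrow> w uA r) ?F" for r
    unfolding w_def by (intro tendsto_intros negashift_tendsto u_tendsto U_tendsto UA)
  have y_tendsto: "((\<lambda>e. y (u e) k r) \<longlongrightarrow> y uA k r) ?F" for k r
    unfolding y_def by (intro iterates_tendsto w_tendsto)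
  note uy_tendsto = ip_tendsto[OF u_tendsto y_tendsto, of ?N]
  have "- K < ip ?N uA (y uA k)" if "k \<le> n" for k
  proof -
    have "\<bar>ip ?N uA (y uA k)\<bar> \<le> (\<Sum>k\<le>n. \<bar>ip ?N uA (y uA k)\<bar>)"
      using that by (intro member_le_sum) auto
    then show ?thesis unfolding K_def by linarith
  qed
  \<comment> \<open>The inequality is strict at \<open>uA\<close>, so by continuity it persists for
    small \<open>e > 0\<close>.\<close>
  then have "\<forall>\<^sub>F e in ?F. \<forall>k\<in>{..n}. - K < ip ?N (u e) (y (u e) k)"
    by (intro eventually_ball_finite ballI order_tendstoD(1)[OF uy_tendsto]) auto
  moreover have "\<forall>\<^sub>F e in ?F. 0 < e"
    by (simp add: eventually_at_right_less)
  ultimately have "\<forall>\<^sub>F e in ?F. 0 \<le> certificate ?a n k0 j0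
      + (\<Sum>k\<in>{k0<..n}. certificate ?a n k k0 * (e * K + e * ip ?N (u e) (y (u e) k)))
      + e * (\<Sum>r<?N. (resid ?N (y (u e) n) r - (if n = k0 then w (u e) r else 0))\<^sup>2) * real ?N * ip ?N (u e) (u e) / 8"
  proof eventually_elim
    case (elim e)
    have u: "ip ?N (u e) (?x0 k) = ip ?N uA (?x0 k) + e * ip ?N uB (?x0 k)" for k
      unfolding u_def ip_lincomb_left ..
    have u_gt: "ip ?N (u e) (?x0 k) = e * K" if "k0 < k" "k \<le> n" for k
      using that j0 by (simp add: u uA uB)
    have "0 \<le> ip ?N (u e) (?x0 k) + e * ip ?N (u e) (y (u e) k)" if "k0 < k" "k \<le> n" for k
    proof -
      have "- K < ip ?N (u e) (y (u e) k)"
        using elim(1) that by simp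
      then have "0 \<le> e * (K + ip ?N (u e) (y (u e) k))"
        using elim(2) by (intro mult_nonneg_nonneg) simp_all
      then show ?thesis using u_gt[OF that] by (simp add: distrib_left)
    qed
    then have "0 \<le> certificate ?a n k0 j0
      + (\<Sum>k\<in>{k0<..n}. certificate ?a n k k0 * (ip ?N (u e) (?x0 k) + e * ip ?N (u e) (y (u e) k)))
      + e * (\<Sum>r<?N. (resid ?N (y (u e) n) r - (if n = k0 then w (u e) r else 0))\<^sup>2) * real ?N * ip ?N (u e) (u e) / 8"
      using rate j0 elim by (intro certificate_perturbed_ge) (auto simp: u uA uB w_def y_def)
    also have "(\<Sum>k\<in>{k0<..n}. certificate ?a n k k0 * (ip ?N (u e) (?x0 k) + e * ip ?N (u e) (y (u e) k)))
      = (\<Sum>k\<in>{k0<..n}. certificate ?a n k k0 * (e * K + e * ip ?N (u e) (y (u e) k)))"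
      by (intro sum.cong refl) (simp add: u_gt)
    finally show ?case .
  qed
  \<comment> \<open>The limits of the residuals and inner products are finite, so the extra factor
    \<open>e\<close> removes every term except the certificate.\<close>
  moreover have "((\<lambda>e. certificate ?a n k0 j0
      + (\<Sum>k\<in>{k0<..n}. certificate ?a n k k0 * (e * K + e * ip ?N (u e) (y (u e) k)))
      + e * (\<Sum>r<?N. (resid ?N (y (u e) n) r - (if n = k0 then w (u e) r else 0))\<^sup>2) * real ?N * ip ?N (u e) (u e) / 8)
    \<longlongrightarrow> certificate ?a n k0 j0
      + (\<Sum>k\<in>{k0<..n}. certificate ?a n k k0 * (0 * K + 0 * ip ?N uA (y uA k)))
      + 0 * (\<Sum>r<?N. (resid ?N (y uA n) r - (if n = k0 then w uA r else 0))\<^sup>2) * real ?N * ip ?N uA uA / 8) ?F"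
  proof -
    have "((\<lambda>e. if n = k0 then w (u e) r else 0) \<longlongrightarrow> (if n = k0 then w uA r else 0)) ?F" for r
      using w_tendsto by simp
    then show ?thesis
      by (intro tendsto_intros uy_tendsto U_tendsto resid_tendsto y_tendsto) auto
  qed
  ultimately show ?thesis
    using tendsto_lowerbound[of _ _ ?F 0] by fastforce
qed

section \<open>Translation to the H-invariants and H-certificates\<close>

theorem theorem3:
  fixes N :: nat and H :: "real mat"
  assumes "N \<ge> 2"
    and "H \<in> carrier_mat (N - 1) (N - 1)"
    and "lower_triangular H"
  shows "achieves_optimal_rate N H \<longleftrightarrow>
    (\<forall>m\<in>{1..N - 1}. P_inv (N - 1) m H = 1 / real N * real (N choose (m + 1))) \<and>
    (\<forall>k\<in>{2..N}. \<forall>j\<in>{1..k - 1}. H_certificate N H k j \<ge> 0)"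
proof -
  let ?a = "\<lambda>i j. H $$ (i, j)"
  obtain n where N: "N = Suc n"
    using assms(1) by (cases N) auto
  have "(\<forall>m\<in>{1..N - 1}. P_inv (N - 1) m H = 1 / real N * real (N choose (m + 1))) \<longleftrightarrow>
      (\<forall>m\<in>{1..n}. (\<Sum>j\<le>n. chain_weight ?a n m j) = real (Suc n choose Suc m) / real (Suc n))"
    by (simp add: N P_inv_eq del: chain_weight.simps)
  also have "\<dots> \<longleftrightarrow>
      (\<forall>m\<le>n. (\<Sum>j\<le>n. chain_weight ?a n m j) = real (Suc n choose Suc m) / real (Suc n))"
  proof -
    \<comment> \<open>The P-conditions start at \<open>m = 1\<close>; at \<open>m = 0\<close> both
      sides are \<open>1\<close>.\<close>
    have "(\<Sum>j\<le>n. chain_weight ?a n 0 j) = real (Suc n choose Suc 0) / real (Suc n)"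
      by (simp del: of_nat_Suc)
    then show ?thesis
      by (metis One_nat_def atLeastAtMost_iff le_zero_eq not_less_eq_eq)
  qed
  finally have P: "(\<forall>m\<in>{1..N - 1}. P_inv (N - 1) m H = 1 / real N * real (N choose (m + 1))) \<longleftrightarrow>
      (\<forall>m\<le>n. (\<Sum>j\<le>n. chain_weight ?a n m j) = real (Suc n choose Suc m) / real (Suc n))" .
  have L: "(\<forall>k\<in>{2..N}. \<forall>j\<in>{1..k - 1}. H_certificate N H k j \<ge> 0) \<longleftrightarrow>
      (\<forall>k j. j < k \<longrightarrow> k \<le> n \<longrightarrow> 0 \<le> certificate ?a n k j)"
  proof (intro iffI allI impI ballI)
    fix k j assume cert: "\<forall>k\<in>{2..N}. \<forall>j\<in>{1..k - 1}. H_certificate N H k j \<ge> 0" and jk: "j < k" "k \<le> n"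
    then have "0 \<le> H_certificate N H (Suc k) (Suc j)"
      by (auto simp: N)
    then show "0 \<le> certificate ?a n k j"
      using H_certificate_eq[OF jk, of H] by (simp add: N)
  next
    fix k j assume cert: "\<forall>k j. j < k \<longrightarrow> k \<le> n \<longrightarrow> 0 \<le> certificate ?a n k j"
      and kj: "k \<in> {2..N}" "j \<in> {1..k - 1}"
    obtain k' where k': "k = Suc k'" using kj by (cases k) auto
    obtain j' where j': "j = Suc j'" using kj by (cases j) auto
    have jk: "j' < k'" "k' \<le> n" using kj by (auto simp: k' j' N)
    then show "0 \<le> H_certificate N H k j"
      using cert H_certificate_eq[OF jk, of H] by (simp add: N k' j')
  qed
  show ?thesis
    unfolding P L
  proof (intro iffI conjI allI impI)
    fix m assume "achieves_optimal_rate N H" "m \<le> n"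
    then show "(\<Sum>j\<le>n. chain_weight ?a n m j) = real (Suc n choose Suc m) / real (Suc n)"
      using rate_imp_optimal(2)[of n H m] by (simp only: N)
  next
    fix k j assume "achieves_optimal_rate N H" "j < k" "k \<le> n"
    then show "0 \<le> certificate ?a n k j"
      using rate_imp_certificate_nonneg[of n H j k] by (simp only: N)
  next
    assume "(\<forall>m\<le>n. (\<Sum>j\<le>n. chain_weight ?a n m j) = real (Suc n choose Suc m) / real (Suc n)) \<and>
      (\<forall>k j. j < k \<longrightarrow> k \<le> n \<longrightarrow> 0 \<le> certificate ?a n k j)"
    then show "achieves_optimal_rate N H"
      unfolding N by (intro achieves_optimal_rateI) blast+
  qed
qed

end
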